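(* As $s\to\infty$, $$\left(\sqrt{2}\ln 2-o(1)\right)2^{\frac{s}{2}}< r'_2(s)\leq \left\lceil\frac{13}{48}2^s\right\rceil.$$ That is, there is a function $\varepsilon(s)\to 0$ (as $s\to\infty$) such that for all sufficiently large integers $s$ one has $(\sqrt{2}\ln 2-\varepsilon(s))2^{s/2}<r'_2(s)\leq \lceil \frac{13}{48}2^s\rceil$.
   Context: All graphs are finite and simple. A threshold graph of order $s$ is an $s$-vertex graph that can be constructed from the one-vertex graph by repeatedly adding a new vertex that is either adjacent to all the previous vertices or nonadjacent to all the previous vertices. For a positive integer $s$, $r'_2(s)$ is the minimum integer $n$ such that every $n$-vertex graph contains a threshold graph of order $s$ as an induced subgraph. *)

theory Defs
  imports Complex_Main "HOL-Library.Ramsey"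
begin

text \<open>A graph is given by a vertex set and a set of unordered pairs of distinct vertices
  (\<open>nsets V 2\<close> is the set of 2-element subsets of \<open>V\<close>).\<close>

definition simple_graph :: "'a set \<Rightarrow> 'a set set \<Rightarrow> bool" where
  "simple_graph V E \<longleftrightarrow> finite V \<and> E \<subseteq> nsets V 2"

definition induced_edges :: "'a set set \<Rightarrow> 'a set \<Rightarrow> 'a set set" where
  "induced_edges E S = {e \<in> E. e \<subseteq> S}"

inductive threshold_graph :: "'a set \<Rightarrow> 'a set set \<Rightarrow> bool" where
  one_vertex: "threshold_graph {v} {}"
| add_isolated: "\<lbrakk>threshold_graph V E; v \<notin> V\<rbrakk> \<Longrightarrow> threshold_graph (insert v V) E"
| add_dominating: "\<lbrakk>threshold_graph V E; v \<notin> V\<rbrakk> \<Longrightarrow>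
    threshold_graph (insert v V) (E \<union> (\<lambda>u. {u, v}) ` V)"

definition contains_induced_threshold :: "'a set \<Rightarrow> 'a set set \<Rightarrow> nat \<Rightarrow> bool" where
  "contains_induced_threshold V E s \<longleftrightarrow>
    (\<exists>S \<subseteq> V. card S = s \<and> threshold_graph S (induced_edges E S))"

text \<open>Every finite graph is isomorphic to one whose vertices are natural numbers, so
  quantifying over graphs on subsets of \<open>nat\<close> loses no generality. The minimum is only
  meaningful for \<open>s \<ge> 1\<close>, since threshold graphs are nonempty.\<close>

definition r2' :: "nat \<Rightarrow> nat" where
  "r2' s = (LEAST n. \<forall>(V :: nat set) E. simple_graph V E \<and> card V = n \<longrightarrow>
              contains_induced_threshold V E s)"

end

theory Submission
  imports Defs "HOL-Real_Asymp.Real_Asymp"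
begin

text \<open>Lower bound: the ordered partitions into alternating blocks of isolated and dominating vertices
  show that there are at most \<open>2 s! / (ln 2)\<^sup>s\<close> threshold graphs on \<open>s\<close> labelled vertices. In a
  random graph, the event that a given \<open>s\<close>-set induces a threshold graph depends only on the pairs
  inside the set, so the local lemma applies; it gains a factor 2 over the union bound.

  Upper bound: deleting the last vertex of a threshold graph leaves one inside a neighbourhood or a
  non-neighbourhood. Hence an upper bound \<open>m\<close> for order \<open>s\<close> gives \<open>2 m\<close> for order \<open>s + 1\<close>, and even
  \<open>2 m - 1\<close> if \<open>m\<close> is even, by the handshake lemma. Started at 18 for order 6, this recursion
  produces exactly \<open>\<lceil>13/48 2\<^sup>s\<rceil>\<close>. For the start, Goodman's count of
  monochromatic triangles is tight at every level: on 9 vertices all neighbourhoods of a graph avoiding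
  order 5 are perfect matchings, and on 18 vertices equality forces a 9-regular graph in which every
  neighbourhood is such a 9-vertex graph; there a non-adjacent pair with 5 common neighbours would
  induce a pentagon inside a neighbourhood, which cannot exist.\<close>

section \<open>Counting threshold graphs\<close>

text \<open>Consecutive additions of the same kind commute, so they are merged into one block
  \<open>K\<close>; ordering blocks instead of single vertices avoids overcounting. The index
  \<open>b\<close> is the kind of the last block, \<open>True\<close> for dominating, and the kinds
  alternate.\<close>

inductive blocks :: "bool \<Rightarrow> 'a set \<Rightarrow> 'a set set \<Rightarrow> bool" where
  empty: "blocks b {} {}"
| block: "\<lbrakk>blocks (\<not> b) S E; finite K; K \<noteq> {}; K \<inter> S = {}\<rbrakk> \<Longrightarrow>
    blocks b (S \<union> K) (if b then E \<union> {e \<in> nsets (S \<union> K) 2. e \<inter> K \<noteq> {}} else E)"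

lemma nsets_2_insert:
  assumes "v \<notin> V"
  shows "{e \<in> nsets (insert v V) 2. e \<inter> insert v K \<noteq> {}}
    = {e \<in> nsets V 2. e \<inter> K \<noteq> {}} \<union> (\<lambda>u. {u, v}) ` V"
proof (intro equalityI subsetI)
  fix e assume e: "e \<in> {e \<in> nsets (insert v V) 2. e \<inter> insert v K \<noteq> {}}"
  then obtain x y where xy: "e = {x, y}" "x \<noteq> y" by (auto simp: nsets_def card_2_iff)
  show "e \<in> {e \<in> nsets V 2. e \<inter> K \<noteq> {}} \<union> (\<lambda>u. {u, v}) ` V"
  proof (cases "v \<in> e")
    case True
    then have "e = {if x = v then y else x, v}" "(if x = v then y else x) \<in> V"
      using xy e by (auto simp: nsets_def)
    then show ?thesis by blast
  next
    case False
    then show ?thesis using e by (auto simp: nsets_def)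
  qed
next
  fix e assume "e \<in> {e \<in> nsets V 2. e \<inter> K \<noteq> {}} \<union> (\<lambda>u. {u, v}) ` V"
  then show "e \<in> {e \<in> nsets (insert v V) 2. e \<inter> insert v K \<noteq> {}}"
    using assms by (auto simp: nsets_def card_insert_if)
qed

lemma blocks_singleton:
  assumes "blocks (\<not> b) V E" "v \<notin> V"
  shows "blocks b (insert v V) (if b then E \<union> (\<lambda>u. {u, v}) ` V else E)"
proof -
  have eq: "V \<union> {v} = insert v V" by simp
  have star: "{e \<in> nsets (insert v V) 2. e \<inter> {v} \<noteq> {}} = (\<lambda>u. {u, v}) ` V"
    using nsets_2_insert[OF assms(2), of "{}"] by simp
  show ?thesis
    using block[OF assms(1), of "{v}", unfolded eq star] assms(2) by simp
qed

lemma blocks_extend: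
  assumes "blocks b V E" "v \<notin> V"
  shows "blocks b (insert v V) (if b then E \<union> (\<lambda>u. {u, v}) ` V else E)"
  using assms(1)
proof cases
  case empty
  have "blocks (\<not> b) V E" unfolding empty by (rule blocks.empty)
  then show ?thesis by (rule blocks_singleton[OF _ assms(2)])
next
  case (block S E' K)
  have "blocks b (S \<union> insert v K)
      (if b then E' \<union> {e \<in> nsets (S \<union> insert v K) 2. e \<inter> insert v K \<noteq> {}} else E')"
    by (rule blocks.block) (use block assms(2) in auto)
  moreover have "{e \<in> nsets (S \<union> insert v K) 2. e \<inter> insert v K \<noteq> {}}
      = {e \<in> nsets V 2. e \<inter> K \<noteq> {}} \<union> (\<lambda>u. {u, v}) ` V"
    using nsets_2_insert[OF assms(2), of K] block(1) by simp
  moreover have "S \<union> insert v K = insert v V" using block(1) by simp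
  ultimately show ?thesis
    unfolding block(2) by (simp add: Un_assoc block(1) split: if_splits)
qed

text \<open>A new vertex enlarges the last block if it has the same kind, and otherwise opens a new
  block of its own.\<close>

lemma threshold_graph_blocks:
  assumes "threshold_graph V E"
  shows "\<exists>b. blocks b V E"
  using assms
proof induction
  case (one_vertex v)
  show ?case using blocks_singleton[of False "{}" "{}" v] blocks.empty by auto
next
  case (add_isolated V E v)
  then obtain b where "blocks b V E" by blast
  then have "blocks False (insert v V) E"
    using blocks_singleton[of False V E v, simplified] blocks_extend[of False V E v, simplified]
      add_isolated(2) by (metis (full_types))
  then show ?case by blast
next
  case (add_dominating V E v)
  then obtain b where "blocks b V E" by blast
  then have "blocks True (insert v V) (E \<union> (\<lambda>u. {u, v}) ` V)"
    using blocks_singleton[of True V E v, simplified] blocks_extend[of True V E v, simplified]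
      add_dominating(2) by (metis (full_types))
  then show ?case by blast
qed

lemma sum_exp_ln_2: "(\<Sum>k\<le>n. ln 2 ^ k / fact k :: real) \<le> 2"
proof -
  have "(\<Sum>k\<le>n. ln 2 ^ k /\<^sub>R fact k :: real) \<le> (\<Sum>k. ln 2 ^ k /\<^sub>R fact k)"
    by (intro sum_le_suminf summable_exp_generic) auto
  also have "\<dots> = exp (ln 2)" by (simp add: exp_def)
  finally show ?thesis by (simp add: scaleR_conv_of_real field_simps)
qed

lemma sum_Pow_card:
  fixes f :: "nat \<Rightarrow> real"
  assumes "finite S"
  shows "(\<Sum>K\<in>Pow S. f (card K)) = (\<Sum>k\<le>card S. real (card S choose k) * f k)"
proof -
  have "(\<Sum>K\<in>Pow S. f (card K)) = (\<Sum>k\<le>card S. \<Sum>K\<in>{K \<in> Pow S. card K = k}. f (card K))"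
    by (rule sum.group[symmetric]) (use assms in \<open>auto intro: card_mono\<close>)
  also have "\<dots> = (\<Sum>k\<le>card S. real (card S choose k) * f k)"
    using n_subsets[OF assms] by (intro sum.cong) auto
  finally show ?thesis .
qed

text \<open>The exponential generating function of block sequences is \<open>1 / (2 - exp x)\<close>, whose pole
  at \<open>ln 2\<close> is the origin of the growth rate.\<close>

lemma card_blocks:
  assumes "finite S"
  shows "finite {E. blocks b S E} \<and> real (card {E. blocks b S E}) \<le> fact (card S) / ln 2 ^ card S"
  using assms
proof (induction "card S" arbitrary: S b rule: less_induct)
  case less
  show ?case
  proof (cases "S = {}")
    case True
    have "{E. blocks b S E} = {{}}"
      unfolding True by (auto elim: blocks.cases intro: blocks.empty)
    then show ?thesis by (simp add: True)
  next
    case False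
    define n where "n = card S"
    \<comment> \<open>\<open>g K E\<close> restores the edge set from the last block
      \<open>K\<close> and the edges \<open>E\<close> on the remaining vertices, so the graphs on
      \<open>S\<close> are bounded by a sum over \<open>K\<close>.\<close>
    define g where "g K E = (if b then E \<union> {e \<in> nsets S 2. e \<inter> K \<noteq> {}} else E)" for K E
    define P where "P = Pow S - {{}}"
    define c where "c K = real (card {E. blocks (\<not> b) (S - K) E})" for K
    have fin: "finite P" using less.prems by (simp add: P_def)
    have IH: "finite {E. blocks (\<not> b) (S - K) E}"
      "c K \<le> fact (n - card K) / ln 2 ^ (n - card K)" if "K \<in> P" for K
    proof -
      have K: "K \<subseteq> S" "K \<noteq> {}" "finite K"
        using that less.prems finite_subset[of K S] by (auto simp: P_def)
      then have "card (S - K) < card S"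
        using less.prems by (intro psubset_card_mono) auto
      moreover have "card (S - K) = n - card K" using K by (simp add: card_Diff_subset n_def)
      ultimately show "finite {E. blocks (\<not> b) (S - K) E}"
        "c K \<le> fact (n - card K) / ln 2 ^ (n - card K)"
        using less.hyps[of "S - K" "\<not> b"] less.prems by (simp_all add: c_def)
    qed
    have sub: "{E. blocks b S E} \<subseteq> (\<Union>K\<in>P. g K ` {E. blocks (\<not> b) (S - K) E})"
    proof
      fix E assume "E \<in> {E. blocks b S E}"
      then have "blocks b S E" by simp
      then show "E \<in> (\<Union>K\<in>P. g K ` {E. blocks (\<not> b) (S - K) E})"
      proof cases
        case empty
        then show ?thesis using False by simp
      next
        case (block S' E' K)
        have "S - K = S'" "K \<in> P" using block by (auto simp: P_def)
        moreover have "E = g K E'" using block by (simp add: g_def)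
        ultimately show ?thesis using block by blast
      qed
    qed
    have fin_sub: "finite (\<Union>K\<in>P. g K ` {E. blocks (\<not> b) (S - K) E})"
      using fin IH(1) by blast
    \<comment> \<open>Blocks are nonempty; setting \<open>f 0 = 0\<close> lets the sum run over all
      subsets.\<close>
    define f where "f k = (if k = 0 then 0 else fact (n - k) / ln 2 ^ (n - k) :: real)" for k
    have "card {E. blocks b S E} \<le> card (\<Union>K\<in>P. g K ` {E. blocks (\<not> b) (S - K) E})"
      by (rule card_mono[OF fin_sub sub])
    also have "\<dots> \<le> (\<Sum>K\<in>P. card (g K ` {E. blocks (\<not> b) (S - K) E}))"
      by (rule card_UN_le[OF fin])
    also have "\<dots> \<le> (\<Sum>K\<in>P. card {E. blocks (\<not> b) (S - K) E})"
      by (intro sum_mono card_image_le IH(1))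
    finally have "real (card {E. blocks b S E}) \<le> (\<Sum>K\<in>P. c K)"
      unfolding c_def of_nat_sum[symmetric] of_nat_le_iff .
    also have "\<dots> \<le> (\<Sum>K\<in>P. f (card K))"
    proof (rule sum_mono)
      fix K assume K: "K \<in> P"
      then have "card K \<noteq> 0" using less.prems finite_subset[of K S] by (auto simp: P_def)
      then show "c K \<le> f (card K)" using IH(2)[OF K] by (simp add: f_def)
    qed
    also have "\<dots> = (\<Sum>K\<in>Pow S. f (card K))"
      unfolding P_def using less.prems by (intro sum.mono_neutral_left) (auto simp: f_def)
    also have "\<dots> = (\<Sum>k\<le>n. real (n choose k) * f k)"
      unfolding n_def by (rule sum_Pow_card[OF less.prems])
    also have "\<dots> = (\<Sum>k\<le>n. fact n / ln 2 ^ n * (ln 2 ^ k / fact k) - (if k = 0 then fact n / ln 2 ^ n else 0))"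
    proof (rule sum.cong[OF refl])
      fix k assume k: "k \<in> {..n}"
      show "real (n choose k) * f k
        = fact n / ln 2 ^ n * (ln 2 ^ k / fact k) - (if k = 0 then fact n / ln 2 ^ n else 0)"
      proof (cases "k = 0")
        case False
        have "ln 2 ^ n = (ln 2 ^ k * ln 2 ^ (n - k) :: real)"
          using k by (simp flip: power_add)
        then show ?thesis
          using False k by (simp add: f_def binomial_fact)
      qed (simp add: f_def)
    qed
    also have "\<dots> = fact n / ln 2 ^ n * ((\<Sum>k\<le>n. ln 2 ^ k / fact k) - 1)"
      by (simp add: sum_subtractf sum_distrib_left right_diff_distrib)
    \<comment> \<open>The truncated series of \<open>exp (ln 2) = 2\<close> without its constant
      term is at most 1, so the bound reproduces itself. This is what singles out
      \<open>ln 2\<close>.\<close>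
    also have "\<dots> \<le> fact n / ln 2 ^ n * 1"
      using sum_exp_ln_2[of n] by (intro mult_left_mono) auto
    finally show ?thesis
      using finite_subset[OF sub fin_sub] by (simp add: n_def)
  qed
qed

text \<open>The factor 2 stands for the two possible kinds of the last block.\<close>

lemma card_threshold_graphs:
  assumes "finite S"
  shows "finite {E. threshold_graph S E}"
    and "real (card {E. threshold_graph S E}) \<le> 2 * (fact (card S) / ln 2 ^ card S)"
proof -
  have sub: "{E. threshold_graph S E} \<subseteq> {E. blocks True S E} \<union> {E. blocks False S E}"
  proof
    fix E assume "E \<in> {E. threshold_graph S E}"
    then obtain b where "blocks b S E" using threshold_graph_blocks by blast
    then have "blocks True S E \<or> blocks False S E" by (metis (full_types))
    then show "E \<in> {E. blocks True S E} \<union> {E. blocks False S E}" by blast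
  qed
  have fin: "finite ({E. blocks True S E} \<union> {E. blocks False S E})"
    using card_blocks[OF assms] by simp
  show "finite {E. threshold_graph S E}"
    using finite_subset[OF sub fin] .
  have "card {E. threshold_graph S E} \<le> card {E. blocks True S E} + card {E. blocks False S E}"
    using card_mono[OF fin sub] card_Un_le order_trans by blast
  then have "real (card {E. threshold_graph S E})
      \<le> real (card {E. blocks True S E}) + real (card {E. blocks False S E})" by linarith
  then show "real (card {E. threshold_graph S E}) \<le> 2 * (fact (card S) / ln 2 ^ card S)"
    using card_blocks[OF assms, of True] card_blocks[OF assms, of False] by linarith
qed

section \<open>The local lemma and the lower bound\<close>

text \<open>Independence under the uniform measure on subsets of \<open>U\<close>: a subset splits
  freely into its parts inside and outside \<open>F\<close>.\<close>

lemma card_independent: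
  fixes A B :: "'a set \<Rightarrow> bool"
  assumes U: "finite U" "F \<subseteq> U"
    and A: "\<And>\<omega>. \<omega> \<subseteq> U \<Longrightarrow> A \<omega> = A (\<omega> \<inter> F)"
    and B: "\<And>\<omega>. \<omega> \<subseteq> U \<Longrightarrow> B \<omega> = B (\<omega> - F)"
  shows "card {\<omega>. \<omega> \<subseteq> U \<and> A \<omega> \<and> B \<omega>}
    = card {\<omega>. \<omega> \<subseteq> F \<and> A \<omega>} * card {\<omega>. \<omega> \<subseteq> U - F \<and> B \<omega>}"
proof -
  let ?X = "{\<omega>. \<omega> \<subseteq> F \<and> A \<omega>}" and ?Y = "{\<omega>. \<omega> \<subseteq> U - F \<and> B \<omega>}"
  have "bij_betw (\<lambda>(x, y). x \<union> y) (?X \<times> ?Y) {\<omega>. \<omega> \<subseteq> U \<and> A \<omega> \<and> B \<omega>}"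
  proof (rule bij_betw_byWitness[where f' = "\<lambda>\<omega>. (\<omega> \<inter> F, \<omega> - F)"])
    show "\<forall>p\<in>?X \<times> ?Y. ((case p of (x, y) \<Rightarrow> x \<union> y) \<inter> F, (case p of (x, y) \<Rightarrow> x \<union> y) - F) = p"
      by auto
    show "\<forall>\<omega>\<in>{\<omega>. \<omega> \<subseteq> U \<and> A \<omega> \<and> B \<omega>}. (case (\<omega> \<inter> F, \<omega> - F) of (x, y) \<Rightarrow> x \<union> y) = \<omega>"
      by auto
    show "(\<lambda>(x, y). x \<union> y) ` (?X \<times> ?Y) \<subseteq> {\<omega>. \<omega> \<subseteq> U \<and> A \<omega> \<and> B \<omega>}"
    proof clarify
      fix x y assume xy: "x \<subseteq> F" "A x" "y \<subseteq> U - F" "B y"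
      then have "x \<union> y \<subseteq> U" "(x \<union> y) \<inter> F = x" "(x \<union> y) - F = y" using U(2) by auto
      then show "x \<union> y \<subseteq> U \<and> A (x \<union> y) \<and> B (x \<union> y)"
        using A[of "x \<union> y"] B[of "x \<union> y"] xy by simp
    qed
    show "(\<lambda>\<omega>. (\<omega> \<inter> F, \<omega> - F)) ` {\<omega>. \<omega> \<subseteq> U \<and> A \<omega> \<and> B \<omega>} \<subseteq> ?X \<times> ?Y"
      using A B by auto
  qed
  from bij_betw_same_card[OF this] show ?thesis by (simp add: card_cartesian_product)
qed

text \<open>The symmetric local lemma in counting form, where event \<open>i\<close> depends only on
  the coordinates in \<open>F i\<close>. By induction on \<open>card J\<close>, conditioned on
  avoiding all events of \<open>J\<close>, every event has probability at most
  \<open>2 * p\<close>.\<close>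

lemma local_lemma:
  fixes A :: "'i \<Rightarrow> 'a set \<Rightarrow> bool" and F :: "'i \<Rightarrow> 'a set" and p d :: real
  assumes U: "finite U" and I: "finite I"
    and F: "\<And>i. i \<in> I \<Longrightarrow> F i \<subseteq> U" "\<And>i. i \<in> I \<Longrightarrow> F i \<noteq> {}"
    and A: "\<And>i \<omega>. i \<in> I \<Longrightarrow> \<omega> \<subseteq> U \<Longrightarrow> A i \<omega> = A i (\<omega> \<inter> F i)"
    and p: "\<And>i. i \<in> I \<Longrightarrow> real (card {\<omega>. \<omega> \<subseteq> F i \<and> A i \<omega>}) \<le> p * 2 ^ card (F i)"
    and d: "\<And>i. i \<in> I \<Longrightarrow> real (card {j \<in> I. F i \<inter> F j \<noteq> {}}) \<le> d"
    and small: "4 * p * d \<le> 1" and "0 \<le> p"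
  shows "\<exists>\<omega>\<subseteq>U. \<forall>i\<in>I. \<not> A i \<omega>"
proof (cases "I = {}")
  case False
  define avoid where "avoid J \<omega> \<longleftrightarrow> (\<forall>j\<in>J. \<not> A j \<omega>)" for J \<omega>
  define N where "N J = real (card {\<omega>. \<omega> \<subseteq> U \<and> avoid J \<omega>})" for J
  define M where "M i J = real (card {\<omega>. \<omega> \<subseteq> U \<and> A i \<omega> \<and> avoid J \<omega>})" for i J
  have fin: "finite {\<omega>. \<omega> \<subseteq> U \<and> P \<omega>}" for P
    using U by (rule rev_finite_subset[OF finite_Pow_iff[THEN iffD2]]) auto
  \<comment> \<open>Each event is counted among its own neighbours, since \<open>F i\<close> is
    nonempty.\<close>
  have "1 \<le> d"
  proof -
    obtain i where i: "i \<in> I" using False by blast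
    then have "card {i} \<le> card {j \<in> I. F i \<inter> F j \<noteq> {}}"
      using I F(2)[OF i] by (intro card_mono) auto
    then show ?thesis using d[OF i] by simp
  qed
  have "p * 1 \<le> p * d" using \<open>1 \<le> d\<close> \<open>0 \<le> p\<close> by (rule mult_left_mono)
  then have p_small: "p \<le> 1 / 4" using small by simp
  have indep: "M i J \<le> p * N J" if i: "i \<in> I" and J: "J \<subseteq> I" "\<And>j. j \<in> J \<Longrightarrow> F i \<inter> F j = {}" for i J
  proof -
    have loc: "avoid J \<omega> = avoid J (\<omega> - F i)" if "\<omega> \<subseteq> U" for \<omega>
    proof -
      have "A j \<omega> = A j (\<omega> - F i)" if j: "j \<in> J" for j
      proof -
        have "(\<omega> - F i) \<inter> F j = \<omega> \<inter> F j" using J(2)[OF j] by blast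
        then show ?thesis
          using A[of j \<omega>] A[of j "\<omega> - F i"] j J(1) \<open>\<omega> \<subseteq> U\<close> by auto
      qed
      then show ?thesis by (simp add: avoid_def)
    qed
    let ?y = "card {\<omega>. \<omega> \<subseteq> U - F i \<and> avoid J \<omega>}"
    have "M i J = real (card {\<omega>. \<omega> \<subseteq> F i \<and> A i \<omega>}) * real ?y"
      unfolding M_def using card_independent[OF U F(1)[OF i], of "A i" "avoid J"] A[OF i] loc
      by (simp flip: of_nat_mult)
    also have "\<dots> \<le> (p * 2 ^ card (F i)) * real ?y"
      by (intro mult_right_mono p i) simp
    also have "N J = real (2 ^ card (F i)) * real ?y"
    proof -
      have "card {\<omega>. \<omega> \<subseteq> F i \<and> True} = 2 ^ card (F i)"
        using card_Pow[of "F i"] F(1)[OF i] U finite_subset by (auto simp: Pow_def)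
      then show ?thesis
        unfolding N_def of_nat_mult[symmetric] of_nat_eq_iff
        using card_independent[OF U F(1)[OF i], of "\<lambda>_. True" "avoid J"] loc by simp
    qed
    then have "(p * 2 ^ card (F i)) * real ?y = p * N J" by simp
    finally show ?thesis .
  qed
  \<comment> \<open>Union bound over the additional events \<open>K\<close>.\<close>
  have N_ge: "N (J \<union> K) \<ge> N J - (\<Sum>j\<in>K. M j J)" if "finite K" for J K
  proof -
    have "{\<omega>. \<omega> \<subseteq> U \<and> avoid J \<omega>}
        \<subseteq> {\<omega>. \<omega> \<subseteq> U \<and> avoid (J \<union> K) \<omega>} \<union> (\<Union>j\<in>K. {\<omega>. \<omega> \<subseteq> U \<and> A j \<omega> \<and> avoid J \<omega>})"
      by (auto simp: avoid_def)
    then have "card {\<omega>. \<omega> \<subseteq> U \<and> avoid J \<omega>}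
        \<le> card ({\<omega>. \<omega> \<subseteq> U \<and> avoid (J \<union> K) \<omega>} \<union> (\<Union>j\<in>K. {\<omega>. \<omega> \<subseteq> U \<and> A j \<omega> \<and> avoid J \<omega>}))"
      by (intro card_mono finite_UnI finite_UN_I that fin)
    also have "\<dots> \<le> card {\<omega>. \<omega> \<subseteq> U \<and> avoid (J \<union> K) \<omega>}
        + card (\<Union>j\<in>K. {\<omega>. \<omega> \<subseteq> U \<and> A j \<omega> \<and> avoid J \<omega>})"
      by (rule card_Un_le)
    also have "\<dots> \<le> card {\<omega>. \<omega> \<subseteq> U \<and> avoid (J \<union> K) \<omega>}
        + (\<Sum>j\<in>K. card {\<omega>. \<omega> \<subseteq> U \<and> A j \<omega> \<and> avoid J \<omega>})"
      by (intro add_left_mono card_UN_le that)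
    finally have "N J \<le> N (J \<union> K) + (\<Sum>j\<in>K. M j J)"
      unfolding N_def M_def of_nat_sum[symmetric] of_nat_add[symmetric] of_nat_le_iff .
    then show ?thesis by simp
  qed
  have "N J > 0 \<and> (\<forall>i\<in>I. M i J \<le> 2 * p * N J)" if "J \<subseteq> I" for J
    using that
  proof (induction "card J" arbitrary: J rule: less_induct)
    case less
    have finJ: "finite J" using less.prems I finite_subset by blast
    have pos: "N J > 0"
    proof (cases "J = {}")
      case True
      have "{} \<in> {\<omega>. \<omega> \<subseteq> U \<and> avoid J \<omega>}" by (simp add: True avoid_def)
      then show ?thesis using fin[of "avoid J"] by (auto simp: N_def card_gt_0_iff)
    next
      case False
      then obtain j where j: "j \<in> J" by blast
      have "card (J - {j}) < card J" using finJ j by (rule card_Diff1_less)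
      then have IH: "N (J - {j}) > 0" "M j (J - {j}) \<le> 2 * p * N (J - {j})"
        using less.hyps[of "J - {j}"] less.prems j by blast+
      have "(J - {j}) \<union> {j} = J" using j by blast
      then have "N (J - {j}) - M j (J - {j}) \<le> N J"
        using N_ge[of "{j}" "J - {j}"] by simp
      \<comment> \<open>As \<open>p\<close> is at most 1/4, forbidding one more event loses at most
        half of the remaining subsets.\<close>
      moreover have "p * N (J - {j}) \<le> 1 / 4 * N (J - {j})"
        using p_small IH(1) by (intro mult_right_mono) auto
      ultimately show ?thesis using IH by linarith
    qed
    have "M i J \<le> 2 * p * N J" if i: "i \<in> I" for i
    proof -
      \<comment> \<open>Event \<open>i\<close> is independent of the events in \<open>L\<close>, so
        dropping \<open>K\<close> from the conditions costs only the ratio of \<open>N L\<close> to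
        \<open>N J\<close>. If \<open>K\<close> is nonempty, \<open>L\<close> is smaller than
        \<open>J\<close>, and by induction the at most \<open>d\<close> events of \<open>K\<close>
        remove at most half of \<open>N L\<close>.\<close>
      define K where "K = {j \<in> J. F i \<inter> F j \<noteq> {}}"
      define L where "L = J - K"
      have JLK: "J = L \<union> K" "finite K" "K \<subseteq> J" using finJ by (auto simp: K_def L_def)
      have "M i J \<le> M i L"
        unfolding M_def of_nat_le_iff
        by (rule card_mono[OF fin]) (auto simp: avoid_def JLK(1))
      also have "\<dots> \<le> p * N L"
        by (rule indep[OF i]) (use less.prems in \<open>auto simp: L_def K_def\<close>)
      also have "\<dots> \<le> p * (2 * N J)"
      proof (cases "K = {}")
        case True
        then show ?thesis using JLK(1) pos \<open>0 \<le> p\<close> by (intro mult_left_mono) auto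
      next
        case False
        have "L \<subset> J" using False JLK by (auto simp: L_def)
        then have "card L < card J" using finJ by (rule psubset_card_mono[rotated])
        then have IH: "N L > 0" "\<And>j. j \<in> I \<Longrightarrow> M j L \<le> 2 * p * N L"
          using less.hyps[of L] less.prems by (auto simp: L_def)
        have "real (card K) \<le> d"
        proof -
          have "card K \<le> card {j \<in> I. F i \<inter> F j \<noteq> {}}"
            using I less.prems by (intro card_mono) (auto simp: K_def)
          then show ?thesis using d[OF i] by linarith
        qed
        have "(\<Sum>j\<in>K. M j L) \<le> real (card K) * (2 * p * N L)"
          by (rule sum_bounded_above) (use IH JLK less.prems in auto)
        also have "\<dots> \<le> d * (2 * p * N L)"
          using IH(1) \<open>0 \<le> p\<close> \<open>real (card K) \<le> d\<close> by (intro mult_right_mono) auto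
        also have "\<dots> = (4 * p * d) * (N L / 2)" by simp
        also have "\<dots> \<le> 1 * (N L / 2)"
          using small IH(1) by (intro mult_right_mono) auto
        finally have "N L \<le> 2 * N J"
          using N_ge[OF JLK(2), of L] JLK(1) by simp
        then show ?thesis using \<open>0 \<le> p\<close> by (rule mult_left_mono)
      qed
      finally show ?thesis by simp
    qed
    with pos show ?case by blast
  qed
  then have "N I > 0" by blast
  then have "{\<omega>. \<omega> \<subseteq> U \<and> avoid I \<omega>} \<noteq> {}"
    by (auto simp: N_def card_gt_0_iff)
  then show ?thesis by (auto simp: avoid_def)
qed auto

section \<open>Parameters and asymptotics of the lower bound\<close>

lemma card_supersets:
  assumes "finite V" "card e = 2" "2 \<le> s"
  shows "card {T \<in> nsets V s. e \<subseteq> T} * fact (s - 2) \<le> card V ^ (s - 2)"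
proof -
  have e: "finite e" using assms(2) by (metis card.infinite zero_neq_numeral)
  have "card {T \<in> nsets V s. e \<subseteq> T} \<le> card (nsets V (s - 2))"
  proof (rule card_inj_on_le)
    show "inj_on (\<lambda>T. T - e) {T \<in> nsets V s. e \<subseteq> T}" by (auto simp: inj_on_def)
    show "(\<lambda>T. T - e) ` {T \<in> nsets V s. e \<subseteq> T} \<subseteq> nsets V (s - 2)"
      using assms e by (auto simp: nsets_def card_Diff_subset)
    show "finite (nsets V (s - 2))" using assms(1) by (rule finite_imp_finite_nsets)
  qed
  also have "\<dots> = card V choose (s - 2)" by simp
  finally have "card {T \<in> nsets V s. e \<subseteq> T} * fact (s - 2) \<le> (card V choose (s - 2)) * fact (s - 2)"
    by simp
  also have "\<dots> \<le> card V ^ (s - 2)" by (rule binomial_fact_pow)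
  finally show ?thesis .
qed

text \<open>Two events interact only if their \<open>s\<close>-sets share a pair, so
  \<open>d\<close> involves \<open>s\<close>-sets through a fixed pair. This leaves the exponent
  \<open>s - 2\<close> on \<open>card V\<close>, where the union bound would have
  \<open>s\<close>.\<close>

lemma exists_graph_without_threshold:
  fixes V :: "'a set"
  assumes V: "finite V" and s: "2 \<le> s"
    and small: "4 * real s ^ 4 * real (card V) ^ (s - 2) \<le> ln 2 ^ s * 2 ^ (s choose 2)"
  shows "\<exists>E. simple_graph V E \<and> \<not> contains_induced_threshold V E s"
proof -
  define n where "n = card V"
  \<comment> \<open>\<open>p\<close> divides the bound on labelled threshold graphs by the number of
    all graphs on \<open>s\<close> vertices; \<open>d\<close> adds up the \<open>s\<close>-sets
    through each pair of a given \<open>s\<close>-set.\<close>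
  define p :: real where "p = 2 * (fact s / ln 2 ^ s) / 2 ^ (s choose 2)"
  define d :: real where "d = real (s choose 2) * (real n ^ (s - 2) / fact (s - 2))"
  have "\<exists>E\<subseteq>nsets V 2. \<forall>S\<in>nsets V s. \<not> threshold_graph S (E \<inter> nsets S 2)"
  proof (rule local_lemma[where F = "\<lambda>S. nsets S 2" and p = p and d = d])
    show "finite (nsets V 2)" "finite (nsets V s)"
      using V by (simp_all add: finite_imp_finite_nsets)
    show "nsets S 2 \<subseteq> nsets V 2" if "S \<in> nsets V s" for S
      using that by (auto simp: nsets_def)
    show "nsets S 2 \<noteq> {}" if "S \<in> nsets V s" for S
      using that s by (simp add: nsets_eq_empty_iff) (auto simp: nsets_def)
    show "threshold_graph S (E \<inter> nsets S 2) = threshold_graph S (E \<inter> nsets S 2 \<inter> nsets S 2)" for S E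
      by (simp add: Int_assoc)
    show "real (card {E. E \<subseteq> nsets S 2 \<and> threshold_graph S (E \<inter> nsets S 2)}) \<le> p * 2 ^ card (nsets S 2)"
      if "S \<in> nsets V s" for S
    proof -
      have S: "finite S" "card S = s" using that by (auto simp: nsets_def)
      have "{E. E \<subseteq> nsets S 2 \<and> threshold_graph S (E \<inter> nsets S 2)} \<subseteq> {E. threshold_graph S E}"
        by (auto simp: Int_absorb2)
      then have "card {E. E \<subseteq> nsets S 2 \<and> threshold_graph S (E \<inter> nsets S 2)} \<le> card {E. threshold_graph S E}"
        by (rule card_mono[OF card_threshold_graphs(1)[OF S(1)]])
      then show ?thesis
        using card_threshold_graphs(2)[OF S(1)] S(2) by (simp add: p_def)
    qed
    show "real (card {T \<in> nsets V s. nsets S 2 \<inter> nsets T 2 \<noteq> {}}) \<le> d" if "S \<in> nsets V s" for S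
    proof -
      have S: "finite S" "card S = s" using that by (auto simp: nsets_def)
      have finS: "finite (nsets S 2)" using S(1) by (rule finite_imp_finite_nsets)
      have fin: "finite {T \<in> nsets V s. e \<subseteq> T}" for e
        using finite_imp_finite_nsets[OF V] by simp
      have "{T \<in> nsets V s. nsets S 2 \<inter> nsets T 2 \<noteq> {}} \<subseteq> (\<Union>e\<in>nsets S 2. {T \<in> nsets V s. e \<subseteq> T})"
        by (auto simp: nsets_def)
      then have "card {T \<in> nsets V s. nsets S 2 \<inter> nsets T 2 \<noteq> {}}
          \<le> card (\<Union>e\<in>nsets S 2. {T \<in> nsets V s. e \<subseteq> T})"
        using finS fin by (intro card_mono finite_UN_I)
      also have "\<dots> \<le> (\<Sum>e\<in>nsets S 2. card {T \<in> nsets V s. e \<subseteq> T})"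
        using finS by (rule card_UN_le)
      finally have "real (card {T \<in> nsets V s. nsets S 2 \<inter> nsets T 2 \<noteq> {}})
          \<le> (\<Sum>e\<in>nsets S 2. real (card {T \<in> nsets V s. e \<subseteq> T}))"
        unfolding of_nat_sum[symmetric] of_nat_le_iff .
      also have "\<dots> \<le> (\<Sum>e\<in>nsets S 2. real n ^ (s - 2) / fact (s - 2))"
      proof (rule sum_mono)
        fix e assume "e \<in> nsets S 2"
        then have "card e = 2" by (simp add: nsets_def)
        from card_supersets[OF V this s]
        have "real (card {T \<in> nsets V s. e \<subseteq> T} * fact (s - 2)) \<le> real (card V ^ (s - 2))"
          by (simp only: of_nat_le_iff)
        then have "real (card {T \<in> nsets V s. e \<subseteq> T}) * fact (s - 2) \<le> real n ^ (s - 2)"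
          by (simp add: n_def)
        then show "real (card {T \<in> nsets V s. e \<subseteq> T}) \<le> real n ^ (s - 2) / fact (s - 2)"
          by (simp add: pos_le_divide_eq)
      qed
      also have "\<dots> = d" using S by (simp add: d_def)
      finally show ?thesis .
    qed
    show "4 * p * d \<le> 1"
    proof -
      \<comment> \<open>The factorials of \<open>p\<close> and \<open>d\<close> cancel up to this
        factor. What remains is polynomial in \<open>s\<close> and tends to 1 under the root of
        order \<open>s - 2\<close>.\<close>
      have fs: "fact s / fact (s - 2) = real s * (real s - 1)"
        using s by (auto simp: le_iff_add numeral_2_eq_2 field_simps)
      have ch: "real (s choose 2) = real s * (real s - 1) / 2"
        using s by (simp add: choose_two real_of_nat_div of_nat_diff)
      have "4 * p * d = 4 * (real s * (real s - 1)) ^ 2 * real n ^ (s - 2) / (ln 2 ^ s * 2 ^ (s choose 2))"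
      proof -
        have "4 * p * d = 8 * (fact s / fact (s - 2)) * real (s choose 2) * real n ^ (s - 2)
            / (ln 2 ^ s * 2 ^ (s choose 2))"
          by (simp add: p_def d_def mult_ac)
        then show ?thesis unfolding fs ch by (simp add: power2_eq_square)
      qed
      also have "\<dots> \<le> 4 * real s ^ 4 * real n ^ (s - 2) / (ln 2 ^ s * 2 ^ (s choose 2))"
      proof -
        have "(real s * (real s - 1)) ^ 2 \<le> (real s * real s) ^ 2"
          using s by (intro power_mono mult_left_mono) auto
        also have "\<dots> = real s ^ 4" by (simp add: power2_eq_square power4_eq_xxxx mult.assoc)
        finally show ?thesis by (intro divide_right_mono mult_right_mono) auto
      qed
      also have "\<dots> \<le> 1" using small by (simp add: n_def divide_le_eq)
      finally show ?thesis .
    qed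
    show "0 \<le> p" by (simp add: p_def)
  qed
  then obtain E where E: "E \<subseteq> nsets V 2" "\<And>S. S \<in> nsets V s \<Longrightarrow> \<not> threshold_graph S (E \<inter> nsets S 2)"
    by blast
  have "induced_edges E S = E \<inter> nsets S 2" if "finite S" for S
    using E(1) that by (auto simp: induced_edges_def nsets_def)
  then have "\<not> contains_induced_threshold V E s"
    using E(2) V finite_subset[of _ V] by (auto simp: contains_induced_threshold_def nsets_def)
  moreover have "simple_graph V E" using V E(1) by (simp add: simple_graph_def)
  ultimately show ?thesis by blast
qed

text \<open>For \<open>s > 2\<close>, the value of \<open>card V\<close> at which the smallness
  condition of \<open>exists_graph_without_threshold\<close> becomes an equality.\<close>

definition lower_bound :: "nat \<Rightarrow> real" where
  "lower_bound s = (ln 2 ^ s * 2 ^ (s choose 2) / (4 * real s ^ 4)) powr (1 / (real s - 2))"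

text \<open>Taking logarithms, \<open>(s choose 2) / (s - 2)\<close> equals s/2 + 1/2 + o(1); the
  extra 1/2 yields \<open>sqrt 2\<close>. The roots of \<open>ln 2 ^ s\<close> and
  \<open>4 * s ^ 4\<close> tend to \<open>ln 2\<close> and 1.\<close>

lemma lower_bound_asymp:
  "(\<lambda>s. lower_bound s / 2 powr (real s / 2)) \<longlonglongrightarrow> sqrt 2 * ln 2"
proof -
  have "((\<lambda>s::real. exp ((s * ln (ln 2) + s * (s - 1) / 2 * ln 2 - ln (4 * s ^ 4)) / (s - 2) - s / 2 * ln 2))
      \<longlongrightarrow> exp (ln (ln 2) + ln 2 / 2)) at_top"
    by real_asymp
  then have lim: "(\<lambda>s. exp ((real s * ln (ln 2) + real s * (real s - 1) / 2 * ln 2 - ln (4 * real s ^ 4)) / (real s - 2) - real s / 2 * ln 2))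
      \<longlonglongrightarrow> exp (ln (ln 2) + ln 2 / 2)"
    by (rule filterlim_compose[OF _ filterlim_real_sequentially])
  have const: "exp (ln (ln 2) + ln 2 / 2) = sqrt 2 * ln (2 :: real)"
  proof -
    have "exp (ln 2 / 2) = sqrt (2 :: real)"
      by (simp add: powr_half_sqrt[symmetric] powr_def)
    then show ?thesis by (simp add: exp_add)
  qed
  have "\<forall>\<^sub>F s in sequentially.
      exp ((real s * ln (ln 2) + real s * (real s - 1) / 2 * ln 2 - ln (4 * real s ^ 4)) / (real s - 2) - real s / 2 * ln 2)
      = lower_bound s / 2 powr (real s / 2)"
    using eventually_gt_at_top[of 2]
  proof eventually_elim
    case (elim s)
    have ch: "real (s choose 2) = real s * (real s - 1) / 2"
      using elim by (simp add: choose_two real_of_nat_div of_nat_diff)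
    have "ln (ln 2 ^ s * 2 ^ (s choose 2) / (4 * real s ^ 4))
        = real s * ln (ln 2) + real (s choose 2) * ln 2 - ln (4 * real s ^ 4)"
      using elim by (simp add: ln_div ln_mult ln_realpow)
    moreover have "0 < ln 2 ^ s * 2 ^ (s choose 2) / (4 * real s ^ 4)"
      using elim by simp
    ultimately show ?case
      using elim unfolding lower_bound_def ch by (simp add: powr_def exp_diff)
  qed
  from Lim_transform_eventually[OF lim this] show ?thesis
    unfolding const .
qed

text \<open>Otherwise \<open>r\<close> meets the smallness condition, and a graph on
  \<open>{..<r}\<close> contradicts the assumption.\<close>

lemma lower_bound_less:
  assumes "2 < s" "\<And>(V :: nat set) E. simple_graph V E \<Longrightarrow> card V = r \<Longrightarrow> contains_induced_threshold V E s"
  shows "lower_bound s < real r"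
proof (rule ccontr)
  assume "\<not> lower_bound s < real r"
  then have le: "real r \<le> lower_bound s" by simp
  define x where "x = ln 2 ^ s * 2 ^ (s choose 2) / (4 * real s ^ 4)"
  have x: "0 < x" using assms(1) by (simp add: x_def)
  have "real r ^ (s - 2) \<le> lower_bound s ^ (s - 2)"
    using le by (intro power_mono) auto
  also have "\<dots> = x"
  proof -
    have "lower_bound s ^ (s - 2) = x powr (1 / (real s - 2) * real (s - 2))"
    proof -
      have "lower_bound s = x powr (1 / (real s - 2))" by (simp add: lower_bound_def x_def)
      then show ?thesis using x by (simp add: powr_power)
    qed
    also have "1 / (real s - 2) * real (s - 2) = 1" using assms(1) by (simp add: of_nat_diff)
    finally show ?thesis using x by simp
  qed
  finally have "4 * real s ^ 4 * real (card {..<r}) ^ (s - 2) \<le> ln 2 ^ s * 2 ^ (s choose 2)"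
    using assms(1) by (simp add: x_def pos_le_divide_eq mult.commute)
  then obtain E where "simple_graph {..<r} E" "\<not> contains_induced_threshold {..<r} E s"
    using exists_graph_without_threshold[of "{..<r}" s] assms(1) by auto
  then show False using assms(2)[of "{..<r}" E] by simp
qed

section \<open>Nested neighbourhoods and Goodman's identity\<close>

text \<open>Graphs are relations here, so that the complement \<open>non R\<close> is again an
  object of the same kind; \<open>u \<noteq> v\<close> makes the diagonal values of \<open>R\<close>
  and \<open>non R\<close> harmless.\<close>

definition nb :: "('a \<Rightarrow> 'a \<Rightarrow> bool) \<Rightarrow> 'a set \<Rightarrow> 'a \<Rightarrow> 'a set" where
  "nb R S v = {u \<in> S. u \<noteq> v \<and> R v u}"

definition degree_sum :: "('a \<Rightarrow> 'a \<Rightarrow> bool) \<Rightarrow> 'a set \<Rightarrow> nat" where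
  "degree_sum R S = (\<Sum>v\<in>S. card (nb R S v))"

definition non :: "('a \<Rightarrow> 'a \<Rightarrow> bool) \<Rightarrow> 'a \<Rightarrow> 'a \<Rightarrow> bool" where
  "non R x y \<longleftrightarrow> \<not> R x y"

lemma non_non [simp]: "non (non R) = R"
  by (simp add: non_def fun_eq_iff)

text \<open>\<open>thr R k S\<close> says that \<open>S\<close> contains an induced threshold graph of order \<open>k\<close>: the vertex \<open>v\<close> is the
  one added last, dominating in the first disjunct and isolated in the second.\<close>

fun thr :: "('a \<Rightarrow> 'a \<Rightarrow> bool) \<Rightarrow> nat \<Rightarrow> 'a set \<Rightarrow> bool" where
  "thr R 0 S \<longleftrightarrow> True"
| "thr R (Suc 0) S \<longleftrightarrow> S \<noteq> {}"
| "thr R (Suc (Suc k)) S \<longleftrightarrow>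
    (\<exists>v\<in>S. thr R (Suc k) (nb R S v) \<or> thr R (Suc k) (nb (non R) S v))"

lemma symp_non: "symp R \<Longrightarrow> symp (non R)"
  by (auto simp: symp_def non_def)

lemma finite_nb [simp]: "finite S \<Longrightarrow> finite (nb R S v)"
  by (simp add: nb_def)

lemma nb_mono: "S \<subseteq> T \<Longrightarrow> nb R S v \<subseteq> nb R T v"
  by (auto simp: nb_def)

lemma nb_sym: "symp R \<Longrightarrow> v \<in> S \<Longrightarrow> x \<in> nb R S v \<Longrightarrow> v \<in> nb R S x"
  by (auto simp: nb_def dest: sympD)

lemma nb_split: "S - {v} = nb R S v \<union> nb (non R) S v" "nb R S v \<inter> nb (non R) S v = {}"
  by (auto simp: nb_def non_def)

lemma card_nb_non:
  assumes "finite S" "v \<in> S"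
  shows "Suc (card (nb R S v) + card (nb (non R) S v)) = card S"
proof -
  have "card (S - {v}) = card (nb R S v) + card (nb (non R) S v)"
    unfolding nb_split(1)[of S v R] using assms(1) nb_split(2)[of R S v]
    by (simp add: card_Un_disjoint)
  then show ?thesis
    using assms by (metis card_Suc_Diff1)
qed

text \<open>Complementation exchanges dominating and isolated vertices, so each result below also
  applies to \<open>non R\<close>.\<close>

lemma thr_non: "thr (non R) k S \<longleftrightarrow> thr R k S"
  by (induction R k S rule: thr.induct) auto

lemma thr_mono: "thr R k S \<Longrightarrow> S \<subseteq> T \<Longrightarrow> thr R k T"
proof (induction R k S arbitrary: T rule: thr.induct)
  case (3 R k S)
  then show ?case
    by (metis nb_mono subsetD thr.simps(3))
qed auto

lemma not_thr_nb:
  assumes "\<not> thr R (Suc k) S" "0 < k" "v \<in> S"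
  shows "\<not> thr R k (nb R S v)" "\<not> thr R k (nb (non R) S v)"
  using assms by (cases k; auto)+

section \<open>The handshake lemma and the doubling recursion\<close>

lemma degree_sum_insert:
  assumes "symp R" "finite S" "v \<notin> S"
  shows "degree_sum R (insert v S) = degree_sum R S + 2 * card (nb R S v)"
proof -
  have ins: "card (nb R (insert v S) u) = card (nb R S u) + (if R v u then 1 else 0)" if "u \<in> S" for u
  proof -
    have "nb R (insert v S) u = (if R v u then insert v (nb R S u) else nb R S u)"
      using that assms by (auto simp: nb_def dest: sympD)
    moreover have "v \<notin> nb R S u"
      using assms by (auto simp: nb_def)
    ultimately show ?thesis
      using assms by simp
  qed
  have "nb R S v = {u \<in> S. R v u}"
    using assms(3) by (auto simp: nb_def)
  then have "card (nb R S v) = (\<Sum>u\<in>S. if R v u then 1 else 0)"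
    using assms(2) by (simp add: sum.inter_filter[symmetric])
  moreover have "nb R (insert v S) v = nb R S v"
    by (auto simp: nb_def)
  ultimately show ?thesis
    using assms by (simp add: degree_sum_def ins sum.distrib)
qed

lemma even_degree_sum:
  assumes "symp R" "finite S"
  shows "even (degree_sum R S)"
  using assms(2)
proof induction
  case empty
  then show ?case by (simp add: degree_sum_def)
next
  case (insert v S)
  then show ?case by (simp add: degree_sum_insert[OF assms(1)])
qed

text \<open>The dummy first argument fixes the vertex type. Using \<open>m \<le> card S\<close>
  rather than equality makes the property upward closed in \<open>m\<close>.\<close>

definition forces_thr :: "'a itself \<Rightarrow> nat \<Rightarrow> nat \<Rightarrow> bool" where
  "forces_thr _ s m \<longleftrightarrow>
    (\<forall>(R :: 'a \<Rightarrow> 'a \<Rightarrow> bool) S. symp R \<longrightarrow> finite S \<longrightarrow> m \<le> card S \<longrightarrow> thr R s S)"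

lemma forces_thrD:
  "forces_thr TYPE('a) s m \<Longrightarrow> symp R \<Longrightarrow> finite S \<Longrightarrow> \<not> thr R s (S :: 'a set) \<Longrightarrow> card S < m"
  by (meson forces_thr_def not_le)

text \<open>Pigeonhole: the at least \<open>2 * m - 1\<close> vertices other than \<open>v\<close>
  put \<open>m\<close> of them among its neighbours or its non-neighbours.\<close>

lemma forces_thr_double:
  assumes "forces_thr TYPE('a) s m" "0 < s" "0 < m"
  shows "forces_thr TYPE('a) (Suc s) (2 * m)"
  unfolding forces_thr_def
proof (intro allI impI, rule ccontr)
  fix R and S :: "'a set"
  assume R: "symp R" and S: "finite S" "2 * m \<le> card S" and not: "\<not> thr R (Suc s) S"
  have "S \<noteq> {}" using S assms(3) by auto
  then obtain v where v: "v \<in> S" by blast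
  have "card (nb R S v) < m" "card (nb (non R) S v) < m"
    using forces_thrD[OF assms(1)] R symp_non[OF R] S(1) not_thr_nb[OF not assms(2) v]
    by (simp_all add: thr_non)
  then show False
    using card_nb_non[OF S(1) v, of R] S(2) by linarith
qed

text \<open>A counterexample has exactly \<open>2 * m - 1\<close> vertices and is regular of degree
  \<open>m - 1\<close>. Both numbers are odd for even \<open>m\<close>, contradicting the handshake
  lemma.\<close>

lemma forces_thr_double_even:
  assumes "forces_thr TYPE('a) s m" "0 < s" "0 < m" "even m"
  shows "forces_thr TYPE('a) (Suc s) (2 * m - 1)"
  unfolding forces_thr_def
proof (intro allI impI, rule ccontr)
  fix R and S :: "'a set"
  assume R: "symp R" and S: "finite S" "2 * m - 1 \<le> card S" and not: "\<not> thr R (Suc s) S"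
  have card_S: "card S = 2 * m - 1"
    using forces_thrD[OF forces_thr_double[OF assms(1-3)] R S(1) not] S(2) by simp
  have "card (nb R S v) = m - 1" if v: "v \<in> S" for v
  proof -
    have "card (nb R S v) < m" "card (nb (non R) S v) < m"
      using forces_thrD[OF assms(1)] R symp_non[OF R] S(1) not_thr_nb[OF not assms(2) v]
      by (simp_all add: thr_non)
    then show ?thesis
      using card_nb_non[OF S(1) v, of R] card_S by linarith
  qed
  then have "degree_sum R S = (2 * m - 1) * (m - 1)"
    by (simp add: degree_sum_def card_S)
  then show False
    using even_degree_sum[OF R S(1)] assms(3,4) by auto
qed

lemma forces_thr_1: "forces_thr TYPE('a) 1 1"
  by (auto simp: forces_thr_def)

text \<open>The bounds for orders 1, 2, 3 are 1, 2 and \<open>2 * 2 - 1 = 3\<close>.\<close>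

lemma forces_thr_3: "forces_thr TYPE('a) 3 3"
  using forces_thr_double_even[OF forces_thr_double[OF forces_thr_1[where 'a = 'a]]]
  by (simp add: numeral_eq_Suc)

text \<open>Both sides count ordered triples of distinct vertices. Each triangle of \<open>R\<close>
  or of \<open>non R\<close> contributes 6 to the degree sums. Any other triple of vertices has
  exactly two vertices at which an edge meets a non-edge, so it contributes 2 to the products of
  degree and codegree, hence 6 after the factor 3.\<close>

lemma goodman:
  assumes R: "symp R" and S: "finite S"
  shows "(\<Sum>v\<in>S. degree_sum R (nb R S v) + degree_sum (non R) (nb (non R) S v)
              + 3 * (card (nb R S v) * card (nb (non R) S v)))
         = card S * (card S - 1) * (card S - 2)"
proof -
  \<comment> \<open>Integer indicators of edges, non-edges and distinct pairs allow \<open>q\<close>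
    to be written as \<open>D - r\<close> and multiplied out.\<close>
  define r where "r x y = (if x \<noteq> y \<and> R x y then 1 else 0 :: int)" for x y
  define q where "q x y = (if x \<noteq> y \<and> \<not> R x y then 1 else 0 :: int)" for x y
  define D where "D x y = (if x \<noteq> y then 1 else 0 :: int)" for x y :: 'a
  have r_sym: "r x y = r y x" and D_sym: "D x y = D y x" for x y
    using R by (auto simp: r_def D_def dest: sympD)
  have q: "q x y = D x y - r x y" for x y
    by (auto simp: q_def D_def r_def)
  have rD: "r x y * D x y = r x y" for x y
    by (auto simp: D_def r_def)
  have nb_r: "int (card (nb R T v)) = (\<Sum>x\<in>T. r v x)" if "finite T" for T v
    unfolding nb_def r_def using that by (simp add: sum.inter_filter[symmetric] eq_commute[of v])
  have nb_q: "int (card (nb (non R) T v)) = (\<Sum>x\<in>T. q v x)" if "finite T" for T v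
    unfolding nb_def q_def non_def using that by (simp add: sum.inter_filter[symmetric] eq_commute[of v])
  let ?n = "int (card S)"
  have sumD: "(\<Sum>y\<in>S. D x y) = ?n - 1" if "x \<in> S" for x
  proof -
    have "S \<inter> {y. x \<noteq> y} = S - {x}" by auto
    moreover have "card S \<ge> 1" using that S by (metis card_gt_0_iff empty_iff less_eq_Suc_le One_nat_def)
    ultimately show ?thesis
      using that S by (simp add: D_def sum.If_cases of_nat_diff)
  qed
  have sumDD: "(\<Sum>y\<in>S. D v y * D x y) = ?n - 2" if "v \<in> S" "x \<in> S" "v \<noteq> x" for v x
  proof -
    have "D v y * D x y = (if y \<in> S - {v, x} then 1 else 0)" if "y \<in> S" for y
      using that by (auto simp: D_def)
    then have "(\<Sum>y\<in>S. D v y * D x y) = int (card (S - {v, x}))"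
      using S by (simp add: sum.inter_filter[symmetric] set_diff_eq)
    also have "\<dots> = ?n - 2"
    proof -
      have "card {v, x} \<le> card S"
        by (rule card_mono) (use that S in auto)
      then show ?thesis
        using that S by (simp add: card_Diff_subset of_nat_diff)
    qed
    finally show ?thesis .
  qed
  have dd: "int (degree_sum R (nb R S v)) = (\<Sum>x\<in>S. \<Sum>y\<in>S. r v x * r v y * r x y)" for v
  proof -
    have "int (degree_sum R (nb R S v)) = (\<Sum>x\<in>nb R S v. \<Sum>y\<in>nb R S v. r x y)"
      using S by (simp add: degree_sum_def nb_r)
    also have "\<dots> = (\<Sum>x\<in>S. r v x * (\<Sum>y\<in>S. r v y * r x y))"
      unfolding nb_def r_def using S
      by (auto simp: sum.inter_filter intro!: sum.cong)
    finally show ?thesis by (simp add: sum_distrib_left mult.assoc)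
  qed
  have dq: "int (degree_sum (non R) (nb (non R) S v)) = (\<Sum>x\<in>S. \<Sum>y\<in>S. q v x * q v y * q x y)" for v
  proof -
    have "int (degree_sum (non R) (nb (non R) S v)) = (\<Sum>x\<in>nb (non R) S v. \<Sum>y\<in>nb (non R) S v. q x y)"
      using S by (simp add: degree_sum_def nb_q)
    also have "\<dots> = (\<Sum>x\<in>S. q v x * (\<Sum>y\<in>S. q v y * q x y))"
      unfolding nb_def q_def non_def using S
      by (auto simp: sum.inter_filter intro!: sum.cong)
    finally show ?thesis by (simp add: sum_distrib_left mult.assoc)
  qed
  define d where "d v = int (card (nb R S v))" for v
  have d: "d v = (\<Sum>x\<in>S. r v x)" for v
    using nb_r[OF S] by (simp add: d_def)
  have codeg: "int (card (nb (non R) S v)) = ?n - 1 - d v" if "v \<in> S" for v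
    using card_nb_non[OF S that, of R] by (simp add: d_def)
  \<comment> \<open>The cubic terms in \<open>r\<close> cancel. There remain distinct triples,
    triples with a marked edge, and paths with two edges.\<close>
  have expand: "q v x * q v y * q x y + r v x * r v y * r x y
      = D v x * (D v y * D x y) - r v x * (D v y * D x y) - r v y * (D v x * D y x) - r x y * (D x v * D y v)
        + r v x * (r v y * D x y) + r x v * (r x y * D v y) + r y v * (r y x * D v x)" for v x y
    using r_sym[of v x] r_sym[of v y] r_sym[of x y] D_sym[of v x] D_sym[of v y] D_sym[of x y]
    by (simp add: q algebra_simps)
  have s1: "(\<Sum>y\<in>S. r v x * (D v y * D x y)) = r v x * (?n - 2)" if "v \<in> S" "x \<in> S" for v x
    using sumDD[OF that] by (simp add: sum_distrib_left[symmetric]) (simp add: r_def)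
  have t1: "(\<Sum>v\<in>S. \<Sum>x\<in>S. \<Sum>y\<in>S. r v x * (D v y * D x y)) = (\<Sum>v\<in>S. d v) * (?n - 2)"
    by (simp add: s1 d sum_distrib_right)
  \<comment> \<open>The three linear terms agree up to the order of summation, and so do the three
    quadratic ones below.\<close>
  have t2: "(\<Sum>v\<in>S. \<Sum>x\<in>S. \<Sum>y\<in>S. r v y * (D v x * D y x)) = (\<Sum>v\<in>S. d v) * (?n - 2)"
  proof -
    have "(\<Sum>x\<in>S. \<Sum>y\<in>S. r v y * (D v x * D y x)) = (\<Sum>y\<in>S. \<Sum>x\<in>S. r v y * (D v x * D y x))" for v
      by (rule sum.swap)
    then show ?thesis
      using t1 by simp
  qed
  have t3: "(\<Sum>v\<in>S. \<Sum>x\<in>S. \<Sum>y\<in>S. r x y * (D x v * D y v)) = (\<Sum>v\<in>S. d v) * (?n - 2)"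
  proof -
    have "(\<Sum>v\<in>S. \<Sum>x\<in>S. \<Sum>y\<in>S. r x y * (D x v * D y v)) = (\<Sum>x\<in>S. \<Sum>v\<in>S. \<Sum>y\<in>S. r x y * (D x v * D y v))"
      by (rule sum.swap)
    also have "\<dots> = (\<Sum>v\<in>S. d v) * (?n - 2)"
      by (rule t2)
    finally show ?thesis .
  qed
  have s4: "(\<Sum>x\<in>S. \<Sum>y\<in>S. r v x * (r v y * D x y)) = d v * d v - d v" if "v \<in> S" for v
  proof -
    have *: "r v x * (r v y * D x y) = r v x * r v y - (if y = x then r v x else 0)" for x y
      by (auto simp: D_def r_def)
    show ?thesis
      unfolding * using S by (simp add: sum_subtractf d sum_product)
  qed
  have t4: "(\<Sum>v\<in>S. \<Sum>x\<in>S. \<Sum>y\<in>S. r v x * (r v y * D x y)) = (\<Sum>v\<in>S. d v * d v - d v)"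
    by (simp add: s4)
  have t5: "(\<Sum>v\<in>S. \<Sum>x\<in>S. \<Sum>y\<in>S. r x v * (r x y * D v y)) = (\<Sum>v\<in>S. d v * d v - d v)"
    by (subst sum.swap) (rule t4)
  have t6: "(\<Sum>v\<in>S. \<Sum>x\<in>S. \<Sum>y\<in>S. r y v * (r y x * D v x)) = (\<Sum>v\<in>S. d v * d v - d v)"
  proof -
    have "(\<Sum>x\<in>S. \<Sum>y\<in>S. r y v * (r y x * D v x)) = (\<Sum>y\<in>S. \<Sum>x\<in>S. r y v * (r y x * D v x))" for v
      by (rule sum.swap)
    then show ?thesis
      using t5 by simp
  qed
  have s0: "(\<Sum>y\<in>S. D v x * (D v y * D x y)) = D v x * (?n - 2)" if "v \<in> S" "x \<in> S" for v x
    using sumDD[OF that] by (simp add: sum_distrib_left[symmetric]) (simp add: D_def)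
  have t0: "(\<Sum>v\<in>S. \<Sum>x\<in>S. \<Sum>y\<in>S. D v x * (D v y * D x y)) = ?n * (?n - 1) * (?n - 2)"
    by (simp add: s0 sum_distrib_right[symmetric] sumD)
  have w: "(\<Sum>v\<in>S. d v * (?n - 1 - d v)) = (?n - 1) * (\<Sum>v\<in>S. d v) - (\<Sum>v\<in>S. d v * d v)"
    unfolding sum_distrib_left sum_subtractf[symmetric]
    by (rule sum.cong) (simp_all add: algebra_simps)
  have "(\<Sum>v\<in>S. int (degree_sum R (nb R S v)) + int (degree_sum (non R) (nb (non R) S v))
        + 3 * (int (card (nb R S v)) * int (card (nb (non R) S v))))
      = (\<Sum>v\<in>S. \<Sum>x\<in>S. \<Sum>y\<in>S. q v x * q v y * q x y + r v x * r v y * r x y)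
        + 3 * (\<Sum>v\<in>S. d v * (?n - 1 - d v))"
    by (simp add: dd dq codeg sum.distrib sum_distrib_left d_def[symmetric])
  also have "\<dots> = ?n * (?n - 1) * (?n - 2)"
    unfolding expand sum.distrib sum_subtractf t0 t1 t2 t3 t4 t5 t6 w by algebra
  finally have *: "(\<Sum>v\<in>S. int (degree_sum R (nb R S v)) + int (degree_sum (non R) (nb (non R) S v))
        + 3 * (int (card (nb R S v)) * int (card (nb (non R) S v)))) = ?n * (?n - 1) * (?n - 2)" .
  \<comment> \<open>Truncated subtraction does no harm, as both products vanish for
    \<open>n < 2\<close>.\<close>
  have "int n * (int n - 1) * (int n - 2) = int (n * (n - 1) * (n - 2))" for n
  proof (cases "2 \<le> n")
    case False
    then have "n = 0 \<or> n = 1" by linarith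
    then show ?thesis by auto
  qed (simp add: of_nat_diff)
  then have "int (\<Sum>v\<in>S. degree_sum R (nb R S v) + degree_sum (non R) (nb (non R) S v)
              + 3 * (card (nb R S v) * card (nb (non R) S v)))
         = int (card S * (card S - 1) * (card S - 2))"
    using * by simp
  then show ?thesis
    by (simp only: of_nat_eq_iff)
qed

section \<open>Graphs avoiding small threshold graphs\<close>

definition avoids :: "nat \<Rightarrow> ('a \<Rightarrow> 'a \<Rightarrow> bool) \<Rightarrow> 'a set \<Rightarrow> bool" where
  "avoids k R S \<longleftrightarrow> symp R \<and> finite S \<and> \<not> thr R k S"

lemma avoids_symp: "avoids k R S \<Longrightarrow> symp R"
  and avoids_finite: "avoids k R S \<Longrightarrow> finite S"
  by (simp_all add: avoids_def)

lemma avoids_non: "avoids k R S \<Longrightarrow> avoids k (non R) S"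
  by (simp add: avoids_def symp_non thr_non)

lemma avoids_subset: "avoids k R S \<Longrightarrow> T \<subseteq> S \<Longrightarrow> avoids k R T"
  unfolding avoids_def by (blast intro: thr_mono finite_subset)

lemma avoids_nb:
  assumes "avoids (Suc k) R S" "0 < k" "v \<in> S"
  shows "avoids k R (nb R S v)" "avoids k R (nb (non R) S v)"
  using assms not_thr_nb[of R k S v] unfolding avoids_def by (blast intro: finite_nb)+

lemmas avoids_nb4 = avoids_nb[where k = 3, simplified]
lemmas avoids_nb5 = avoids_nb[where k = 4, simplified]
lemmas avoids_nb6 = avoids_nb[where k = 5, simplified]

section \<open>Avoiding orders 3 and 4\<close>

lemma avoids_3_card: "avoids 3 R S \<Longrightarrow> card S \<le> 2"
  using forces_thrD[OF forces_thr_3, of R S] by (auto simp: avoids_def)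

lemma avoids_4_degree:
  assumes "avoids 4 R S" "v \<in> S"
  shows "card (nb R S v) \<le> 2"
  using avoids_nb4(1)[OF assms] avoids_3_card by blast

lemma avoids_4_card:
  assumes "avoids 4 R S"
  shows "card S \<le> 5"
proof (cases "S = {}")
  case False
  then obtain v where "v \<in> S" by blast
  show ?thesis
    using avoids_4_degree[OF assms \<open>v \<in> S\<close>] avoids_4_degree[OF avoids_non[OF assms] \<open>v \<in> S\<close>]
      card_nb_non[OF avoids_finite[OF assms] \<open>v \<in> S\<close>, of R] by linarith
qed simp

text \<open>Degree and codegree are at most 2 and add up to 4, so the graph is a pentagon.\<close>

lemma avoids_4_card_5:
  assumes "avoids 4 R S" "card S = 5" "v \<in> S"
  shows "card (nb R S v) = 2"
  using avoids_4_degree[OF assms(1,3)] avoids_4_degree[OF avoids_non[OF assms(1)] assms(3)]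
    card_nb_non[OF avoids_finite[OF assms(1)] assms(3), of R] assms(2) by linarith

lemma avoids_4_degree_sum_5:
  assumes "avoids 4 R S" "card S = 5"
  shows "degree_sum R S = 10"
  using avoids_4_card_5[OF assms] assms(2) by (simp add: degree_sum_def)

lemma avoids_4_card_4:
  assumes "avoids 4 R S" "card S = 4" "v \<in> S"
  shows "1 \<le> card (nb R S v)"
  using avoids_4_degree[OF avoids_non[OF assms(1)] assms(3)]
    card_nb_non[OF avoids_finite[OF assms(1)] assms(3), of R] assms(2) by linarith

lemma avoids_4_degree_sum_4:
  assumes "avoids 4 R S" "card S = 4"
  shows "4 \<le> degree_sum R S"
proof -
  have "(\<Sum>v\<in>S. 1) \<le> degree_sum R S"
    unfolding degree_sum_def by (rule sum_mono) (rule avoids_4_card_4[OF assms])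
  then show ?thesis using assms(2) by simp
qed

text \<open>Extracts the equality case from Goodman's count: terms that are all at least their
  average are all equal to it.\<close>

lemma sum_eq_lower_bound:
  fixes f :: "'a \<Rightarrow> nat"
  assumes "finite S" "\<And>v. v \<in> S \<Longrightarrow> c \<le> f v" "sum f S \<le> card S * c" "v \<in> S"
  shows "f v = c"
proof (rule ccontr)
  assume "f v \<noteq> c"
  then have "c < f v" using assms(2)[OF assms(4)] by simp
  then have "(\<Sum>v\<in>S. c) < sum f S"
    using assms(1,2,4) by (intro sum_strict_mono_ex1) blast+
  then show False using assms(3) by simp
qed

section \<open>Avoiding order 5: graphs on 10, 9 and 8 vertices\<close>

lemma avoids_5_degree:
  assumes "avoids 5 R S" "v \<in> S"
  shows "card (nb R S v) \<le> 5"
  using avoids_nb5(1)[OF assms] avoids_4_card by blast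

lemma avoids_5_codegree:
  assumes "avoids 5 R S" "v \<in> S"
  shows "card (nb (non R) S v) \<le> 5"
  using avoids_5_degree[OF avoids_non[OF assms(1)] assms(2)] .

text \<open>On 10 vertices, degree and codegree are 4 and 5 in some order. Each term of Goodman's
  sum is then at least 10 + 4 + 3 * 20 = 74, and 740 exceeds 10 * 9 * 8 = 720.\<close>

lemma avoids_5_card:
  assumes "avoids 5 R S"
  shows "card S \<le> 9"
proof (rule ccontr)
  assume "\<not> card S \<le> 9"
  then have "10 \<le> card S" by simp
  then obtain T where T: "T \<subseteq> S" "card T = 10"
    by (rule obtain_subset_with_card_n)
  have av: "avoids 5 R T" using avoids_subset[OF assms T(1)] .
  let ?f = "\<lambda>v. degree_sum R (nb R T v) + degree_sum (non R) (nb (non R) T v)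
      + 3 * (card (nb R T v) * card (nb (non R) T v))"
  have "74 \<le> ?f v" if v: "v \<in> T" for v
  proof -
    have 4: "avoids 4 R (nb R T v)" "avoids 4 (non R) (nb (non R) T v)"
      using avoids_nb5[OF av v] avoids_non by blast+
    consider "card (nb R T v) = 4" "card (nb (non R) T v) = 5"
      | "card (nb R T v) = 5" "card (nb (non R) T v) = 4"
      using avoids_5_degree[OF av v] avoids_5_codegree[OF av v]
        card_nb_non[OF avoids_finite[OF av] v, of R] T(2) by linarith
    then show ?thesis
      using avoids_4_degree_sum_5[OF 4(1)] avoids_4_degree_sum_5[OF 4(2)]
        avoids_4_degree_sum_4[OF 4(1)] avoids_4_degree_sum_4[OF 4(2)] by cases auto
  qed
  then have "card T * 74 \<le> sum ?f T"
    using sum_bounded_below[of T 74 ?f] by simp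
  also have "\<dots> = 720"
    unfolding goodman[OF avoids_symp[OF av] avoids_finite[OF av]] by (simp add: T(2))
  finally show False by (simp add: T(2))
qed

text \<open>Excludes the one configuration whose Goodman term, 10 + 0 + 45, would fall below the
  average 56: a pentagon \<open>C\<close> around \<open>v\<close> together with a triangle
  \<open>M\<close> of non-neighbours.\<close>

lemma avoids_5_card_9_degree_5:
  assumes av: "avoids 5 R S" and S: "card S = 9" and v: "v \<in> S" and deg: "card (nb R S v) = 5"
  shows "degree_sum (non R) (nb (non R) S v) \<noteq> 0"
proof
  define C where "C = nb R S v"
  define M where "M = nb (non R) S v"
  define X where "X w = nb R C w" for w
  assume "degree_sum (non R) (nb (non R) S v) = 0"
  have fin: "finite S" "finite C" "finite M" using avoids_finite[OF av] by (simp_all add: C_def M_def)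
  have sym: "R a b = R b a" for a b using avoids_symp[OF av] by (auto dest: sympD)
  have "nb (non R) M w = {}" if "w \<in> M" for w
    using that \<open>degree_sum _ _ = 0\<close> fin by (simp add: degree_sum_def M_def)
  then have M_adj: "R w w'" if "w \<in> M" "w' \<in> M" "w \<noteq> w'" for w w'
    using that by (auto simp: nb_def non_def)
  have card_M: "card M = 3"
    using card_nb_non[OF fin(1) v, of R] S deg by (simp add: M_def)
  have card_C: "card C = 5" using deg by (simp add: C_def)
  have C_iff: "u \<in> C \<longleftrightarrow> u \<in> S \<and> u \<noteq> v \<and> R v u" for u
    by (auto simp: C_def nb_def)
  have M_iff: "u \<in> M \<longleftrightarrow> u \<in> S \<and> u \<noteq> v \<and> \<not> R v u" for u
    by (auto simp: M_def nb_def non_def)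
  \<comment> \<open>Among the non-neighbours of \<open>w\<close>, the vertex \<open>v\<close> has
    degree at most 2, so \<open>w\<close> misses at most 2 vertices of \<open>C\<close>. With its 2
    neighbours in \<open>M\<close>, degree at most 5 leaves exactly 3 in \<open>C\<close>.\<close>
  have w: "card (X w) = 3 \<and> nb R S w = X w \<union> (M - {w}) \<and> card (nb R S w) = 5" if w: "w \<in> M" for w
  proof -
    have wS: "w \<in> S" "w \<noteq> v" "\<not> R v w" "w \<notin> C"
      using w by (auto simp: M_iff C_iff)
    have Q: "nb (non R) S w = insert v (nb (non R) C w)"
      using wS M_adj[OF w] sym[of w] v by (auto simp: nb_def non_def C_iff M_iff)
    have "nb R (nb (non R) S w) v = nb (non R) C w"
      by (auto simp: Q C_iff nb_def)
    moreover have "v \<in> nb (non R) S w" by (simp add: Q)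
    ultimately have "card (nb (non R) C w) \<le> 2"
      using avoids_4_degree[OF avoids_nb5(2)[OF av wS(1)], of v] by simp
    moreover have "card C = card (X w) + card (nb (non R) C w)"
      using nb_split[where S = C and v = w and R = R] wS(4) fin(2) card_Un_disjoint[of "X w" "nb (non R) C w"]
      by (simp add: X_def)
    ultimately have "3 \<le> card (X w)"
      using card_C by linarith
    have eq: "nb R S w = X w \<union> (M - {w})"
      using wS M_adj[OF w] sym[of w v] by (auto simp: X_def nb_def C_iff M_iff)
    moreover have "X w \<inter> (M - {w}) = {}"
      by (auto simp: X_def nb_def C_iff M_iff)
    ultimately have "card (nb R S w) = card (X w) + 2"
      using fin card_M w by (simp add: card_Un_disjoint X_def)
    then show ?thesis
      using \<open>3 \<le> card (X w)\<close> avoids_5_degree[OF av wS(1)] eq by linarith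
  qed
  \<comment> \<open>The neighbourhood of \<open>w\<close> has 5 vertices and is a pentagon. There
    \<open>w'\<close> has two neighbours: the third vertex of \<open>M\<close> and one element of
    the intersection.\<close>
  have int: "card (X w \<inter> X w') = 1" if ww: "w \<in> M" "w' \<in> M" "w \<noteq> w'" for w w'
  proof -
    have wS: "w \<in> S" "w' \<in> S" using ww by (auto simp: M_iff)
    have "card (M - {w, w'}) = 1"
      using ww card_M fin by (simp add: card_Diff_subset)
    then obtain w'' where w'': "M - {w, w'} = {w''}"
      by (meson card_1_singletonE)
    have "nb R (nb R S w) w' = insert w'' (X w \<inter> X w')"
    proof -
      have "nb R S w = insert w' (insert w'' (X w))"
        using w[OF ww(1)] w'' ww by auto
      moreover have "R w' w''" "w'' \<noteq> w'" "w' \<notin> X w'"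
        using w'' M_adj[OF ww(2), of w''] by (auto simp: X_def nb_def)
      moreover have "w' \<notin> X w" "X w \<subseteq> C"
        using ww by (auto simp: X_def nb_def C_iff M_iff)
      ultimately show ?thesis
        by (auto simp: nb_def X_def)
    qed
    moreover have "w'' \<notin> X w"
    proof -
      have "w'' \<in> M" using w'' by auto
      then show ?thesis by (auto simp: X_def nb_def C_iff M_iff)
    qed
    moreover have "w' \<in> nb R S w" using w[OF ww(1)] ww by auto
    moreover have "card (nb R (nb R S w) w') = 2"
      using avoids_4_card_5[OF avoids_nb5(1)[OF av wS(1)]] w[OF ww(1)] \<open>w' \<in> nb R S w\<close> by blast
    moreover have "finite (X w)" using fin by (simp add: X_def)
    ultimately show ?thesis by simp
  qed
  obtain a b c where abc: "M = {a, b, c}" "a \<noteq> b" "b \<noteq> c" "a \<noteq> c"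
    using card_M by (metis card_3_iff)
  have finX: "finite (X w)" "X w \<subseteq> C" for w
    using fin by (auto simp: X_def nb_def)
  \<comment> \<open>Two of the sets cover \<open>C\<close>, since 3 + 3 - 1 = 5. The third set meets
    each of them in one vertex only, yet has size 3.\<close>
  have "card (X a \<union> X b) = 5"
    using card_Un_Int[OF finX(1)[of a] finX(1)[of b]] w[of a] w[of b] int[of a b] abc by simp
  then have "X a \<union> X b = C"
    using card_C fin finX by (simp add: card_subset_eq)
  then have "X c = (X c \<inter> X a) \<union> (X c \<inter> X b)"
    using finX[of c] by blast
  then have "card (X c) \<le> card (X c \<inter> X a) + card (X c \<inter> X b)"
    by (metis card_Un_le)
  then show False
    using w[of c] int[of c a] int[of c b] abc by simp
qed

text \<open>Goodman's sum is 9 * 8 * 7 = 9 * 56. Degrees 4 and 4 give at least 4 + 4 + 48 = 56.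
  Degrees 5 and 3 give at least 10 + 2 + 45 = 57, the 2 coming from parity and
  \<open>avoids_5_card_9_degree_5\<close>. Equality everywhere turns each neighbourhood into a
  perfect matching.\<close>

lemma avoids_5_card_9:
  assumes av: "avoids 5 R S" and S: "card S = 9" and v: "v \<in> S"
  shows "card (nb R S v) = 4" "\<And>x. x \<in> nb R S v \<Longrightarrow> card (nb R (nb R S v) x) = 1"
proof -
  let ?f = "\<lambda>v. degree_sum R (nb R S v) + degree_sum (non R) (nb (non R) S v)
      + 3 * (card (nb R S v) * card (nb (non R) S v))"
  have fin: "finite S" using avoids_finite[OF av] .
  have bound: "56 \<le> ?f v \<and> (?f v = 56 \<longrightarrow> card (nb R S v) = 4 \<and> degree_sum R (nb R S v) = 4)"
    if v: "v \<in> S" for v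
  proof -
    have 4: "avoids 4 R (nb R S v)" "avoids 4 (non R) (nb (non R) S v)"
      using avoids_nb5[OF av v] avoids_non by blast+
    have ev: "even (degree_sum R (nb R S v))" "even (degree_sum (non R) (nb (non R) S v))"
      using avoids_symp[OF av] fin by (simp_all add: even_degree_sum symp_non)
    have non0: "card (nb R S v) = 5 \<Longrightarrow> degree_sum (non R) (nb (non R) S v) \<noteq> 0"
      "card (nb (non R) S v) = 5 \<Longrightarrow> degree_sum R (nb R S v) \<noteq> 0"
      using avoids_5_card_9_degree_5[OF av S v] avoids_5_card_9_degree_5[OF avoids_non[OF av] S v]
      unfolding non_non by blast+
    consider "card (nb R S v) = 4" "card (nb (non R) S v) = 4"
      | "card (nb R S v) = 5" "card (nb (non R) S v) = 3"
      | "card (nb R S v) = 3" "card (nb (non R) S v) = 5"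
      using avoids_5_degree[OF av v] avoids_5_codegree[OF av v]
        card_nb_non[OF fin v, of R] S by linarith
    then show ?thesis
    proof cases
      case 1
      then show ?thesis
        using avoids_4_degree_sum_4[OF 4(1)] avoids_4_degree_sum_4[OF 4(2)] by auto
    next
      case 2
      then have "2 \<le> degree_sum (non R) (nb (non R) S v)"
        using non0 ev by (auto elim!: evenE)
      then show ?thesis
        using avoids_4_degree_sum_5[OF 4(1)] 2 by auto
    next
      case 3
      then have "2 \<le> degree_sum R (nb R S v)"
        using non0 ev by (auto elim!: evenE)
      then show ?thesis
        using avoids_4_degree_sum_5[OF 4(2)] 3 by auto
    qed
  qed
  have "?f v = 56"
  proof (rule sum_eq_lower_bound[OF fin _ _ v])
    show "sum ?f S \<le> card S * 56"
      unfolding goodman[OF avoids_symp[OF av] fin] by (simp add: S)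
  qed (use bound in blast)
  with bound[OF v] have *: "card (nb R S v) = 4" "degree_sum R (nb R S v) = 4" by auto
  then show "card (nb R S v) = 4" by blast
  show "card (nb R (nb R S v) x) = 1" if x: "x \<in> nb R S v" for x
    by (rule sum_eq_lower_bound[OF finite_nb[OF fin] _ _ x])
      (use * avoids_4_card_4[OF avoids_nb5(1)[OF av v]] in \<open>auto simp: degree_sum_def\<close>)
qed

lemma nb_insert:
  "nb R (insert u S) v = (if u \<noteq> v \<and> R v u then insert u (nb R S v) else nb R S v)"
  by (auto simp: nb_def)

text \<open>The five non-neighbours of \<open>v\<close> form a pentagon \<open>C\<close>, so only
  the attachment of its two neighbours \<open>x\<close>, \<open>y\<close> to \<open>C\<close> and to
  each other is open. The bound 20 and its equality case enter the count on 18 vertices.\<close>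

lemma avoids_5_card_8_degree_2:
  assumes av: "avoids 5 R S" and S: "card S = 8" and v: "v \<in> S" and deg: "card (nb R S v) = 2"
  shows "20 \<le> degree_sum R S"
    and "degree_sum R S = 20 \<Longrightarrow> u \<in> S \<Longrightarrow> card (nb R S u) \<le> 3"
proof -
  define C where "C = nb (non R) S v"
  have fin: "finite S" "finite C" using avoids_finite[OF av] by (simp_all add: C_def)
  have symR: "symp R" using avoids_symp[OF av] .
  have sym: "R a b = R b a" for a b using symR by (auto dest: sympD)
  obtain x y where xy: "nb R S v = {x, y}" "x \<noteq> y"
    using deg by (meson card_2_iff)
  have card_C: "card C = 5"
    using card_nb_non[OF fin(1) v, of R] S deg by (simp add: C_def)
  have mem: "x \<in> S" "y \<in> S" "R v x" "R v y" "x \<noteq> v" "y \<noteq> v"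
    using xy by (auto simp: nb_def)
  have C_iff: "u \<in> C \<longleftrightarrow> u \<in> S \<and> u \<noteq> v \<and> \<not> R v u" for u
    by (auto simp: C_def nb_def non_def)
  have notC: "v \<notin> C" "x \<notin> C" "y \<notin> C" using mem by (auto simp: C_iff)
  have S_cases: "u \<in> S \<longleftrightarrow> u = v \<or> u = x \<or> u = y \<or> u \<in> C" for u
    using xy v by (auto simp: C_iff nb_def)
  have S_eq: "S = insert v (insert x (insert y C))"
    using S_cases by blast
  have avC: "avoids 4 R C" using avoids_nb5(2)[OF av v] by (simp add: C_def)
  define A where "A = nb R C x"
  define B where "B = nb R C y"
  have AB: "A \<subseteq> C" "B \<subseteq> C" "finite A" "finite B" using fin by (auto simp: A_def B_def nb_def)
  have "nb R C v = {}" by (auto simp: nb_def C_iff)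
  then have "card (nb R (insert x (insert y C)) v) = 2"
    using mem xy(2) by (simp add: nb_insert)
  moreover have "card (nb R (insert y C) x) = card A + (if R x y then 1 else 0)"
  proof -
    have "y \<notin> A" "finite A" using AB notC by blast+
    then show ?thesis using xy(2) by (simp add: nb_insert flip: A_def)
  qed
  \<comment> \<open>The pentagon contributes 10 and the two edges at \<open>v\<close> contribute
    4.\<close>
  ultimately have sum: "degree_sum R S = 14 + 2 * card A + 2 * card B + (if R x y then 2 else 0)"
    unfolding S_eq using fin mem xy(2) notC
    by (simp add: degree_sum_insert[OF symR] avoids_4_degree_sum_5[OF avC card_C] B_def)
  have "20 \<le> degree_sum R S \<and> (degree_sum R S = 20 \<longrightarrow> (\<forall>u\<in>S. card (nb R S u) \<le> 3))"
  proof (cases "R x y")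
    case True
    \<comment> \<open>Otherwise the non-neighbours of \<open>u\<close> are \<open>v\<close>,
      \<open>x\<close>, \<open>y\<close> and its two non-neighbours \<open>p\<close>,
      \<open>q\<close> in \<open>C\<close>. These five form a 2-regular graph containing the
      triangle \<open>v\<close>, \<open>x\<close>, \<open>y\<close>, which leaves \<open>p\<close>
      no neighbour but \<open>q\<close>.\<close>
    have "u \<in> A \<union> B" if u: "u \<in> C" for u
    proof (rule ccontr)
      assume "u \<notin> A \<union> B"
      then have nu: "\<not> R u x" "\<not> R u y" "\<not> R u v"
        using u sym[of x u] sym[of y u] sym[of v u] notC unfolding A_def B_def nb_def C_iff by blast+
      have uS: "u \<in> S" using u S_cases by blast
      define D where "D = nb (non R) S u"
      have D_iff: "z \<in> D \<longleftrightarrow> z \<in> S \<and> z \<noteq> u \<and> \<not> R u z" for z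
        by (auto simp: D_def nb_def non_def)
      have avD: "avoids 4 R D" using avoids_nb5(2)[OF av uS] by (simp add: D_def)
      have "card (nb (non R) C u) = 2"
        using card_nb_non[OF fin(2) u, of R] avoids_4_card_5[OF avC card_C u] card_C by simp
      then obtain p q where pq: "nb (non R) C u = {p, q}" "p \<noteq> q"
        by (meson card_2_iff)
      have pC: "p \<in> C" "q \<in> C" "p \<in> D" "q \<in> D"
        using pq(1) S_cases by (auto simp: nb_def non_def D_iff)
      have "z \<in> D \<longleftrightarrow> z \<in> {v, x, y, p, q}" for z
      proof -
        have "z \<in> C \<and> z \<in> D \<longleftrightarrow> z = p \<or> z = q"
          using pq(1) S_cases[of z] by (auto simp: nb_def non_def D_iff)
        then show ?thesis
          using S_cases[of z] notC pC u nu uS mem v by (auto simp: D_iff)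
      qed
      then have D: "D = {v, x, y, p, q}" by blast
      have "distinct [v, x, y, p, q]"
        using mem xy(2) pq(2) notC pC by auto
      then have "card D = 5"
        unfolding D by simp
      note deg_D = avoids_4_card_5[OF avD this]
      have fD: "finite D" using fin by (simp add: D_def)
      have "{v, y} \<subseteq> nb R D x" "{v, x} \<subseteq> nb R D y"
        using mem True sym xy(2) by (auto simp: nb_def D)
      moreover have "card (nb R D x) = 2" "card (nb R D y) = 2"
        using deg_D by (simp_all add: D)
      ultimately have "nb R D x = {v, y}" "nb R D y = {v, x}"
        using fD mem by (metis card_2_iff card_subset_eq finite_nb)+
      then have "p \<notin> nb R D x" "p \<notin> nb R D y"
        using pC notC by auto
      then have "\<not> R p x" "\<not> R p y" "\<not> R p v"
        using pC notC sym[of x p] sym[of y p] sym[of v p] unfolding nb_def C_iff by blast+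
      then have "nb R D p \<subseteq> {q}"
        by (auto simp: D nb_def)
      then have "card (nb R D p) \<le> 1"
        by (metis card_mono card_1_singleton_iff finite.emptyI finite.insertI One_nat_def)
      then show False using deg_D[OF pC(3)] by simp
    qed
    then have "card C \<le> card (A \<union> B)"
      using AB fin by (intro card_mono) auto
    then have "5 \<le> card A + card B"
      using card_Un_le[of A B] card_C by linarith
    then show ?thesis
      using sum True by simp
  next
    case False
    \<comment> \<open>In the neighbourhood of \<open>a\<close>, the non-neighbours of
      \<open>v\<close> are those of \<open>a\<close> in \<open>C\<close>, hence at most 2. Codegree
      at most 5 gives the lower bound. If it is attained, the non-neighbours of \<open>a\<close>
      form a pentagon, where \<open>b\<close> needs two neighbours.\<close>
    have half: "1 \<le> card (nb R C a) \<and> card (nb R C a) \<le> 2 \<and>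
        (card (nb R C a) = 1 \<longrightarrow> 2 \<le> card (nb R C b - nb R C a))"
      if ab: "nb R S v = {a, b}" "a \<noteq> b" "\<not> R a b" for a b
    proof -
      have mem: "a \<in> S" "b \<in> S" "R v a" "R v b" "a \<noteq> v" "b \<noteq> v"
        using ab by (auto simp: nb_def)
      have S_cases: "u \<in> S \<longleftrightarrow> u = v \<or> u = a \<or> u = b \<or> u \<in> C" for u
        using ab v by (auto simp: C_iff nb_def)
      have notC: "a \<notin> C" "b \<notin> C" using mem by (auto simp: C_iff)
      have Na: "nb R S a = insert v (nb R C a)"
        using S_cases sym[of a v] mem ab by (auto simp: nb_def)
      have v_nb: "v \<notin> nb R C a" by (auto simp: nb_def C_iff)
      have "nb (non R) (nb R S a) v = nb R C a"
        unfolding Na by (auto simp: nb_def non_def C_iff)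
      then have le2: "card (nb R C a) \<le> 2"
        using avoids_4_degree[OF avoids_non[OF avoids_nb5(1)[OF av mem(1)]], of v] Na by simp
      have coN: "nb (non R) S a = insert b (C - nb R C a)"
        using S_cases sym[of a v] mem ab notC by (auto simp: nb_def non_def)
      have cardN: "card (nb R S a) = Suc (card (nb R C a))"
        using Na v_nb fin by simp
      then have ge1: "1 \<le> card (nb R C a)"
        using card_nb_non[OF fin(1) mem(1), of R] avoids_5_codegree[OF av mem(1)] S by linarith
      have "2 \<le> card (nb R C b - nb R C a)" if "card (nb R C a) = 1"
      proof -
        have "card (nb (non R) S a) = 5"
          using cardN that card_nb_non[OF fin(1) mem(1), of R] S by linarith
        moreover have "nb R (nb (non R) S a) b \<subseteq> nb R C b - nb R C a"
          unfolding coN by (auto simp: nb_def)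
        ultimately show ?thesis
          using avoids_4_card_5[OF avoids_nb5(2)[OF av mem(1)], of b] coN
          by (metis card_mono fin(2) finite_Diff finite_nb insertI1)
      qed
      then show ?thesis using le2 ge1 by blast
    qed
    have A: "1 \<le> card A" "card A \<le> 2" "card A = 1 \<Longrightarrow> 2 \<le> card (B - A)"
      using half[OF xy False] by (auto simp: A_def B_def)
    have B: "1 \<le> card B" "card B \<le> 2" "card B = 1 \<Longrightarrow> 2 \<le> card (A - B)"
      using half[of y x] xy False sym[of y x] by (auto simp: A_def B_def insert_commute)
    have le: "card (A - B) \<le> card A" "card (B - A) \<le> card B"
      using AB by (auto intro: card_mono)
    have three: "3 \<le> card A + card B"
      using A B le by linarith
    have "card (nb R S u) \<le> 3" if eq: "degree_sum R S = 20" and u: "u \<in> S" for u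
    proof -
      have AB3: "card A + card B = 3" using sum eq False by simp
      \<comment> \<open>The sizes are 1 and 2, and the larger set must have two elements outside the
        smaller. Being disjoint, \<open>A\<close> and \<open>B\<close> add at most one neighbour to
        each pentagon vertex.\<close>
      have "A \<inter> B = {}"
      proof -
        consider "card A = 1" "card B = 2" | "card A = 2" "card B = 1"
          using AB3 A B by linarith
        then show ?thesis
        proof cases
          case 1
          then have "card (B - A) = card B" using A(3) le by simp
          then have "B - A = B" using AB by (metis Diff_subset card_subset_eq)
          then show ?thesis by blast
        next
          case 2
          then have "card (A - B) = card A" using B(3) le by simp
          then have "A - B = A" using AB by (metis Diff_subset card_subset_eq)
          then show ?thesis by blast
        qed
      qed
      consider "u = v" | "u = x" | "u = y" | "u \<in> C" using u S_cases by blast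
      then show ?thesis
      proof cases
        case 1
        then show ?thesis using deg by simp
      next
        case 2
        have "nb R S x \<subseteq> insert v A"
          using S_cases False by (auto simp: nb_def A_def)
        then have "card (nb R S x) \<le> card (insert v A)"
          using AB by (intro card_mono) auto
        also have "\<dots> \<le> Suc (card A)" by (simp add: card_insert_if AB)
        finally show ?thesis using 2 A(2) by simp
      next
        case 3
        have "nb R S y \<subseteq> insert v B"
          using S_cases False sym[of x y] by (auto simp: nb_def B_def)
        then have "card (nb R S y) \<le> card (insert v B)"
          using AB by (intro card_mono) auto
        also have "\<dots> \<le> Suc (card B)" by (simp add: card_insert_if AB)
        finally show ?thesis using 3 B(2) by simp
      next
        case 4
        have nv: "\<not> R u v" using 4 sym[of u v] by (simp add: C_iff)
        have "\<not> (R u x \<and> R u y)"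
          using \<open>A \<inter> B = {}\<close> 4 notC sym[of x u] sym[of y u] unfolding A_def B_def nb_def by blast
        then obtain z where "nb R S u \<subseteq> insert z (nb R C u)"
          using S_cases nv by (cases "R u x") (auto simp: nb_def)
        then have "card (nb R S u) \<le> card (insert z (nb R C u))"
          using fin by (intro card_mono) auto
        also have "\<dots> \<le> Suc (card (nb R C u))" by (simp add: card_insert_if fin)
        finally show ?thesis using avoids_4_card_5[OF avC card_C 4] by simp
      qed
    qed
    then show ?thesis using sum three by simp
  qed
  then show "20 \<le> degree_sum R S" "degree_sum R S = 20 \<Longrightarrow> u \<in> S \<Longrightarrow> card (nb R S u) \<le> 3"
    by blast+
qed

text \<open>Degrees are at least 2. If none is 2, the sum is at least 24, and the case of equality
  cannot occur.\<close>

lemma avoids_5_card_8: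
  assumes av: "avoids 5 R S" and S: "card S = 8"
  shows "20 \<le> degree_sum R S"
    and "degree_sum R S = 20 \<Longrightarrow> u \<in> S \<Longrightarrow> card (nb R S u) \<le> 3"
proof -
  have "20 \<le> degree_sum R S \<and> (degree_sum R S = 20 \<longrightarrow> (\<forall>u\<in>S. card (nb R S u) \<le> 3))"
  proof (cases "\<exists>v\<in>S. card (nb R S v) = 2")
    case True
    then show ?thesis using avoids_5_card_8_degree_2[OF av S] by blast
  next
    case False
    have "3 \<le> card (nb R S v)" if v: "v \<in> S" for v
    proof -
      have "2 \<le> card (nb R S v)"
        using avoids_5_codegree[OF av v] card_nb_non[OF avoids_finite[OF av] v, of R] S by linarith
      then show ?thesis using False v by (metis le_antisym not_less_eq_eq numeral_2_eq_2 numeral_3_eq_3)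
    qed
    then have "(\<Sum>v\<in>S. 3) \<le> degree_sum R S"
      unfolding degree_sum_def by (rule sum_mono)
    then show ?thesis using S by simp
  qed
  then show "20 \<le> degree_sum R S" "degree_sum R S = 20 \<Longrightarrow> u \<in> S \<Longrightarrow> card (nb R S u) \<le> 3"
    by blast+
qed

section \<open>Avoiding order 6: fewer than 18 vertices\<close>

lemma sum_sum_nb_swap:
  assumes "symp R" "finite A" "finite B"
  shows "(\<Sum>a\<in>A. \<Sum>b\<in>nb R B a. f a b) = (\<Sum>b\<in>B. \<Sum>a\<in>nb R A b. f a b)"
proof -
  have "nb R A b = {a \<in> A. b \<noteq> a \<and> R a b}" for b
    using assms(1) by (auto simp: nb_def dest: sympD)
  moreover have "nb R B a = {b \<in> B. b \<noteq> a \<and> R a b}" for a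
    by (auto simp: nb_def)
  ultimately show ?thesis
    using sum.swap_restrict[OF assms(2,3), of f "\<lambda>a b. b \<noteq> a \<and> R a b"] by simp
qed

text \<open>Each of the 5 edges of the pentagon has a unique common neighbour, one of the 4 vertices outside;
  but none of these 4 vertices can serve two edges.\<close>

lemma avoids_5_no_pentagon:
  assumes av: "avoids 5 R N" and N: "card N = 9"
    and X: "X \<subseteq> N" "card X = 5"
    and two: "\<And>u. u \<in> X \<Longrightarrow> card (nb R X u) = 2"
    and tri: "\<And>u z z'. u \<in> X \<Longrightarrow> z \<in> nb R X u \<Longrightarrow> z' \<in> nb R X u \<Longrightarrow> z \<noteq> z' \<Longrightarrow> \<not> R z z'"
  shows False
proof -
  define W where "W = N - X"
  have fin: "finite N" "finite X" "finite W"
    using avoids_finite[OF av] X(1) finite_subset by (auto simp: W_def)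
  have symR: "symp R" using avoids_symp[OF av] .
  have card_W: "card W = 4"
    using X N fin by (simp add: W_def card_Diff_subset)
  note one = avoids_5_card_9(2)[OF av N]
  \<comment> \<open>The neighbours of \<open>w\<close> in \<open>X\<close> span at most one edge:
    they carry a matching, and there are at most 3 of them.\<close>
  have upper: "degree_sum R (nb R X w) \<le> 2" if w: "w \<in> W" for w
  proof -
    define Y where "Y = nb R X w"
    have wN: "w \<in> N" "w \<notin> X" using w by (auto simp: W_def)
    have Y: "Y \<subseteq> nb R N w" "Y \<subseteq> X" "finite Y"
      using X fin by (auto simp: Y_def nb_def)
    have deg_Y: "card (nb R Y y) \<le> 1" if "y \<in> Y" for y
    proof -
      have "nb R Y y \<subseteq> nb R (nb R N w) y" using Y(1) by (rule nb_mono)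
      then show ?thesis
        using one[OF wN(1), of y] that Y(1) fin by (metis card_mono finite_nb subsetD)
    qed
    \<comment> \<open>With four neighbours, each has at most one neighbour inside \<open>Y\<close>
      and so is adjacent to the remaining vertex \<open>z\<close>, giving \<open>z\<close> degree 4
      in \<open>X\<close>.\<close>
    have "card Y \<noteq> 4"
    proof
      assume Y4: "card Y = 4"
      then have "card (X - Y) = 1"
        using Y X(2) by (simp add: card_Diff_subset)
      then obtain z where z: "X - Y = {z}" by (meson card_1_singletonE)
      have "R y z" if y: "y \<in> Y" for y
      proof (rule ccontr)
        assume "\<not> R y z"
        then have "nb R X y = nb R Y y"
          using z Y(2) by (auto simp: nb_def)
        then show False
          using two[of y] deg_Y[OF y] y Y(2) by auto
      qed
      then have "Y \<subseteq> nb R X z"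
        using z Y(2) symR by (auto simp: nb_def dest: sympD)
      then have "card Y \<le> card (nb R X z)"
        using fin by (intro card_mono) auto
      then show False using Y4 two[of z] z by auto
    qed
    moreover have "card Y \<le> 4"
      using card_mono[OF _ Y(1)] avoids_5_card_9(1)[OF av N wN(1)] fin by simp
    ultimately have "card Y \<le> 3" by simp
    moreover have "degree_sum R Y \<le> card Y"
      using sum_mono[of Y "\<lambda>y. card (nb R Y y)" "\<lambda>_. 1"] deg_Y by (simp add: degree_sum_def)
    moreover have "even (degree_sum R Y)"
      using even_degree_sum[OF symR Y(3)] .
    ultimately have "degree_sum R Y \<le> 2"
      by (cases "degree_sum R Y = 3") auto
    then show ?thesis by (simp add: Y_def)
  qed
  \<comment> \<open>Each edge from \<open>u\<close> to \<open>z\<close> in \<open>X\<close> has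
    exactly one common neighbour in \<open>N\<close>, and by \<open>tri\<close> it lies outside
    \<open>X\<close>.\<close>
  have lower: "(\<Sum>w\<in>nb R W u. card (nb R (nb R X w) u)) = 2" if u: "u \<in> X" for u
  proof -
    have uN: "u \<in> N" using u X by blast
    have eq: "nb R (nb R X w) u = nb R (nb R X u) w" for w
      by (auto simp: nb_def)
    have "(\<Sum>w\<in>nb R W u. card (nb R (nb R X w) u)) = (\<Sum>w\<in>nb R W u. \<Sum>z\<in>nb R (nb R X u) w. 1)"
      by (simp add: eq)
    also have "\<dots> = (\<Sum>z\<in>nb R X u. \<Sum>w\<in>nb R (nb R W u) z. 1)"
      by (rule sum_sum_nb_swap[OF symR]) (use fin in auto)
    also have "\<dots> = (\<Sum>z\<in>nb R X u. 1)"
    proof (rule sum.cong[OF refl])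
      fix z assume z: "z \<in> nb R X u"
      have "nb R (nb R W u) z = nb R (nb R N u) z"
        using tri[OF u z] z by (auto simp: nb_def W_def)
      moreover have "z \<in> nb R N u"
        using z nb_mono[OF X(1)] by blast
      ultimately show "(\<Sum>w\<in>nb R (nb R W u) z. 1) = (1 :: nat)"
        using one[OF uN, of z] by simp
    qed
    finally show ?thesis using two[OF u] by simp
  qed
  \<comment> \<open>Double counting gives 10, but four outside vertices contribute at most 2
    each.\<close>
  have "(\<Sum>w\<in>W. degree_sum R (nb R X w)) = (\<Sum>u\<in>X. \<Sum>w\<in>nb R W u. card (nb R (nb R X w) u))"
    unfolding degree_sum_def by (rule sum_sum_nb_swap[OF symR fin(3,2)])
  also have "\<dots> = 10" using lower X(2) by simp
  finally have "(\<Sum>w\<in>W. degree_sum R (nb R X w)) = 10" .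
  moreover have "(\<Sum>w\<in>W. degree_sum R (nb R X w)) \<le> (\<Sum>w\<in>W. 2)"
    by (rule sum_mono) (rule upper)
  ultimately show False using card_W by simp
qed

text \<open>The assumptions \<open>eq\<close> are the equality case of Goodman's count. They produce
  a non-neighbour \<open>m\<close> of \<open>v\<close> with exactly 5 common neighbours
  \<open>X\<close>, which form the forbidden pentagon in the neighbourhood \<open>N\<close> of
  \<open>v\<close>.\<close>

lemma avoids_6_card_18_degree_9:
  assumes av: "avoids 6 R S" and S: "card S = 18"
    and eq: "\<And>u. u \<in> S \<Longrightarrow> card (nb R S u) = 8 \<Longrightarrow> degree_sum R (nb R S u) = 20"
      "\<And>u. u \<in> S \<Longrightarrow> card (nb (non R) S u) = 8 \<Longrightarrow> degree_sum (non R) (nb (non R) S u) = 20"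
    and v: "v \<in> S"
  shows "card (nb R S v) \<noteq> 9"
proof
  assume deg_v: "card (nb R S v) = 9"
  define N where "N = nb R S v"
  define M where "M = nb (non R) S v"
  have fin: "finite S" "finite N" "finite M"
    using avoids_finite[OF av] by (auto simp: N_def M_def)
  have symR: "symp R" using avoids_symp[OF av] .
  have sym: "R a b = R b a" for a b using symR by (auto dest: sympD)
  have N_iff: "u \<in> N \<longleftrightarrow> u \<in> S \<and> u \<noteq> v \<and> R v u" for u
    by (auto simp: N_def nb_def)
  have M_iff: "u \<in> M \<longleftrightarrow> u \<in> S \<and> u \<noteq> v \<and> \<not> R v u" for u
    by (auto simp: M_def nb_def non_def)
  have avN: "avoids 5 R N" using avoids_nb6(1)[OF av v] by (simp add: N_def)
  have avM: "avoids 5 (non R) M"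
    using avoids_nb6(2)[OF av v] avoids_non by (auto simp: M_def)
  have card_N: "card N = 9" using deg_v by (simp add: N_def)
  have card_M: "card M = 8"
    using card_nb_non[OF fin(1) v, of R] deg_v S by (simp add: M_def)
  have deg_le: "card (nb R S u) \<le> 9" "8 \<le> card (nb R S u)" if u: "u \<in> S" for u
    using avoids_5_card[OF avoids_nb6(1)[OF av u]] avoids_5_card[OF avoids_nb6(2)[OF av u]]
      card_nb_non[OF fin(1) u, of R] S by linarith+
  \<comment> \<open>If \<open>u\<close> had degree 8, its neighbourhood would have degree sum 20 and
    hence maximum degree 3, while \<open>v\<close> has the 4 neighbours of \<open>u\<close> in
    \<open>N\<close> there.\<close>
  have deg_N: "card (nb R S u) = 9" if u: "u \<in> N" for u
  proof (rule ccontr)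
    assume "card (nb R S u) \<noteq> 9"
    moreover have uS: "u \<in> S" using u N_iff by blast
    ultimately have "card (nb R S u) = 8" using deg_le[OF uS] by linarith
    moreover have "v \<in> nb R S u" using nb_sym[OF symR v] u by (simp add: N_def)
    ultimately have "card (nb R (nb R S u) v) \<le> 3"
      using avoids_5_card_8(2)[OF avoids_nb6(1)[OF av uS]] eq(1)[OF uS] by blast
    moreover have "nb R (nb R S u) v = nb R N u"
      by (auto simp: N_def nb_def)
    ultimately show False
      using avoids_5_card_9(1)[OF avN card_N u] by simp
  qed
  have split: "S - {v} = N \<union> M" "N \<inter> M = {}" by (auto simp: N_iff M_iff)
  have deg_split: "card (nb R S u) = (if R v u then 1 else 0) + card (nb R N u) + card (nb R M u)"
    if u: "u \<in> S" "u \<noteq> v" for u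
  proof -
    have "nb R S u = (if R v u then {v} else {}) \<union> (nb R N u \<union> nb R M u)"
      using v u sym[of u v] by (auto simp: nb_def N_iff M_iff)
    moreover have "card (nb R N u \<union> nb R M u) = card (nb R N u) + card (nb R M u)"
      using split(2) fin by (intro card_Un_disjoint) (auto simp: nb_def)
    moreover have "v \<notin> nb R N u \<union> nb R M u"
      by (auto simp: nb_def N_iff M_iff)
    ultimately show ?thesis using fin by simp
  qed
  have NM: "card (nb R M u) = 4" if u: "u \<in> N" for u
    using deg_split[of u] u deg_N[OF u] avoids_5_card_9(1)[OF avN card_N u] by (simp add: N_iff)
  \<comment> \<open>By equality \<open>m\<close> has at most 3 non-neighbours in \<open>M\<close>,
    so at least 4 neighbours there, out of at most 9 in all.\<close>
  have X_le: "card (nb R N m) \<le> 5" if m: "m \<in> M" for m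
  proof -
    have "card (nb (non R) M m) \<le> 3"
      using avoids_5_card_8(2)[OF avM card_M _ m] eq(2)[OF v] card_M by (simp add: M_def)
    then have "4 \<le> card (nb R M m)"
      using card_nb_non[OF fin(3) m, of R] card_M by linarith
    then show ?thesis
      using deg_split[of m] deg_le(1)[of m] m by (simp add: M_iff)
  qed
  \<comment> \<open>The 36 edges between \<open>N\<close> and the 8 vertices of \<open>M\<close>
    force some \<open>m\<close> to receive more than 4.\<close>
  have "(\<Sum>m\<in>M. card (nb R N m)) = (\<Sum>m\<in>M. \<Sum>u\<in>nb R N m. 1)" by simp
  also have "\<dots> = (\<Sum>u\<in>N. \<Sum>m\<in>nb R M u. 1)"
    by (rule sum_sum_nb_swap[OF symR fin(3,2)])
  also have "\<dots> = 36" using NM card_N by simp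
  finally have sum: "(\<Sum>m\<in>M. card (nb R N m)) = 36" .
  have "\<exists>m\<in>M. 5 \<le> card (nb R N m)"
  proof (rule ccontr)
    assume "\<not> ?thesis"
    then have "card (nb R N m) \<le> 4" if "m \<in> M" for m using that by auto
    then have "(\<Sum>m\<in>M. card (nb R N m)) \<le> (\<Sum>m\<in>M. 4)" by (rule sum_mono)
    then show False using sum card_M by simp
  qed
  then obtain m where m: "m \<in> M" "5 \<le> card (nb R N m)" by blast
  define X where "X = nb R N m"
  have mS: "m \<in> S" "m \<noteq> v" "\<not> R v m" "\<not> R m v" using m(1) sym[of m v] by (auto simp: M_iff)
  \<comment> \<open>Work in the 9-vertex neighbourhood \<open>G\<close> of \<open>u\<close>, which
    contains the non-adjacent \<open>v\<close> and \<open>m\<close>. By the matching property of the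
    complement, 2 of the 4 neighbours of \<open>m\<close> in \<open>G\<close> are non-adjacent to
    \<open>v\<close>; the other 2 lie in \<open>X\<close>.\<close>
  have local: "card (nb R X u) = 2"
    "\<And>z z'. z \<in> nb R X u \<Longrightarrow> z' \<in> nb R X u \<Longrightarrow> z \<noteq> z' \<Longrightarrow> \<not> R z z'"
    if u: "u \<in> X" for u
  proof -
    define G where "G = nb R S u"
    have uN: "u \<in> N" "R m u" "m \<noteq> u" using u by (auto simp: X_def nb_def)
    then have uS: "u \<in> S" "R v u" "u \<noteq> v" by (auto simp: N_iff)
    have G_iff: "z \<in> G \<longleftrightarrow> z \<in> S \<and> z \<noteq> u \<and> R u z" for z
      by (auto simp: G_def nb_def)
    have vm: "v \<in> G" "m \<in> G"
      using v mS uN uS sym[of u v] sym[of u m] by (auto simp: G_iff)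
    have avG: "avoids 5 R G" using avoids_nb6(1)[OF av uS(1)] by (simp add: G_def)
    have card_G: "card G = 9" using deg_N[OF uN(1)] by (simp add: G_def)
    have finG: "finite G" using fin by (simp add: G_def)
    define Q where "Q = nb (non R) G v"
    have mQ: "m \<in> Q" using vm mS by (simp add: Q_def nb_def non_def)
    have "card Q = 4"
      using avoids_5_card_9(1)[OF avoids_non[OF avG] card_G vm(1)] by (simp add: Q_def)
    moreover have "card (nb (non R) Q m) = 1"
      using avoids_5_card_9(2)[OF avoids_non[OF avG] card_G vm(1)] mQ by (simp add: Q_def)
    ultimately have "card (nb R Q m) = 2"
      using card_nb_non[of Q m R] mQ finG by (simp add: Q_def)
    moreover have "nb R G m = nb R Q m \<union> nb R X u" "nb R Q m \<inter> nb R X u = {}"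
      using mS uS uN by (auto simp: nb_def Q_def G_iff X_def N_iff non_def)
    moreover have "card (nb R G m) = 4"
      using avoids_5_card_9(1)[OF avG card_G vm(2)] .
    moreover have "finite (nb R Q m)" "finite (nb R X u)"
      using fin finG by (simp_all add: Q_def X_def)
    ultimately show "card (nb R X u) = 2"
      by (simp add: card_Un_disjoint)
    show "\<not> R z z'" if z: "z \<in> nb R X u" "z' \<in> nb R X u" "z \<noteq> z'" for z z'
    proof
      assume zz: "R z z'"
      have zG: "z \<in> G" "z' \<in> nb R G z" "R z v" "R z m" "R z' v" "R z' m" "z \<noteq> v" "z' \<noteq> v" "z \<noteq> m" "z' \<noteq> m"
        using z zz sym[of z v] sym[of z m] sym[of z' v] sym[of z' m]
        by (auto simp: nb_def G_iff X_def N_iff)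
      \<comment> \<open>An edge of \<open>G\<close> has only one common neighbour in
        \<open>G\<close>.\<close>
      have "{v, m} \<subseteq> nb R (nb R G z) z'"
        using zG vm by (auto simp: nb_def)
      then have "card {v, m} \<le> card (nb R (nb R G z) z')"
        using finG by (intro card_mono) auto
      then show False
        using avoids_5_card_9(2)[OF avG card_G zG(1,2)] mS(2) by auto
    qed
  qed
  have "card X = 5" "X \<subseteq> N"
    using X_le[OF m(1)] m(2) by (auto simp: X_def nb_def)
  then show False
    using avoids_5_no_pentagon[OF avN card_N, of X] local by blast
qed

text \<open>Goodman's sum is 18 * 17 * 16 = 18 * 272. Degree and codegree are 8 and 9 in some order,
  so each term is at least 20 + 36 + 3 * 72 = 272. Equality follows, and
  \<open>avoids_6_card_18_degree_9\<close> for \<open>R\<close> and for \<open>non R\<close>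
  excludes both orders.\<close>

lemma avoids_6_card:
  assumes "avoids 6 R S"
  shows "card S < 18"
proof (rule ccontr)
  assume "\<not> card S < 18"
  then have "18 \<le> card S" by simp
  then obtain T where T: "T \<subseteq> S" "card T = 18"
    by (rule obtain_subset_with_card_n)
  have av: "avoids 6 R T" using avoids_subset[OF assms T(1)] .
  have fin: "finite T" using avoids_finite[OF av] .
  let ?f = "\<lambda>v. degree_sum R (nb R T v) + degree_sum (non R) (nb (non R) T v)
      + 3 * (card (nb R T v) * card (nb (non R) T v))"
  have deg: "card (nb R T v) = 8 \<and> card (nb (non R) T v) = 9 \<or>
      card (nb R T v) = 9 \<and> card (nb (non R) T v) = 8" if v: "v \<in> T" for v
    using avoids_5_card[OF avoids_nb6(1)[OF av v]] avoids_5_card[OF avoids_nb6(2)[OF av v]]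
      card_nb_non[OF fin v, of R] T(2) by linarith
  have sum_9: "degree_sum Q A = 36" if "avoids 5 Q A" "card A = 9" for Q and A :: "'a set"
    using avoids_5_card_9(1)[OF that] that(2) by (simp add: degree_sum_def)
  have bound: "272 \<le> ?f v \<and> (?f v = 272 \<longrightarrow>
      (card (nb R T v) = 8 \<longrightarrow> degree_sum R (nb R T v) = 20) \<and>
      (card (nb (non R) T v) = 8 \<longrightarrow> degree_sum (non R) (nb (non R) T v) = 20))"
    if v: "v \<in> T" for v
  proof -
    have 5: "avoids 5 R (nb R T v)" "avoids 5 (non R) (nb (non R) T v)"
      using avoids_nb6[OF av v] avoids_non by blast+
    from deg[OF v] show ?thesis
    proof (elim disjE conjE)
      assume c: "card (nb R T v) = 8" "card (nb (non R) T v) = 9"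
      show ?thesis
        using avoids_5_card_8(1)[OF 5(1) c(1)] sum_9[OF 5(2) c(2)] c by simp
    next
      assume c: "card (nb R T v) = 9" "card (nb (non R) T v) = 8"
      show ?thesis
        using avoids_5_card_8(1)[OF 5(2) c(2)] sum_9[OF 5(1) c(1)] c by simp
    qed
  qed
  have eq: "?f v = 272" if v: "v \<in> T" for v
  proof (rule sum_eq_lower_bound[OF fin _ _ v])
    show "sum ?f T \<le> card T * 272"
      unfolding goodman[OF avoids_symp[OF av] fin] by (simp add: T(2))
  qed (use bound in blast)
  have eq': "card (nb R T v) = 8 \<Longrightarrow> degree_sum R (nb R T v) = 20"
    "card (nb (non R) T v) = 8 \<Longrightarrow> degree_sum (non R) (nb (non R) T v) = 20" if "v \<in> T" for v
    using bound[OF that] eq[OF that] by blast+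
  obtain v where v: "v \<in> T" using T(2) by fastforce
  have "card (nb R T v) \<noteq> 9"
    using avoids_6_card_18_degree_9[OF av T(2) eq' v] .
  moreover have "card (nb (non R) T v) \<noteq> 9"
    using avoids_6_card_18_degree_9[OF avoids_non[OF av] T(2) _ _ v] eq' by simp
  ultimately show False using deg[OF v] by blast
qed

section \<open>The recursion from order 6 upwards\<close>

lemma forces_thr_6: "forces_thr TYPE('a) 6 18"
  unfolding forces_thr_def using avoids_6_card by (metis avoids_def not_le)

lemma forces_thr_even: "forces_thr TYPE('a) (2 * k + 6) (nat \<lceil>(13 / 48 :: real) * 2 ^ (2 * k + 6)\<rceil>) \<and>
   forces_thr TYPE('a) (2 * k + 7) (nat \<lceil>(13 / 48 :: real) * 2 ^ (2 * k + 7)\<rceil>)"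
proof -
  \<comment> \<open>Closed form of the recursion \<open>c (Suc k) = 4 * c k - 2\<close> with
    \<open>c 0 = 18\<close>. The values \<open>c k\<close> at even orders are even, which permits
    the sharper step to \<open>2 * c k - 1\<close>; plain doubling leads to the next even order.
    Rounding up adds 2/3 at even and 1/3 at odd orders.\<close>
  define c :: "nat \<Rightarrow> nat" where "c k = (52 * 4 ^ k + 2) div 3" for k
  have c: "3 * c k = 52 * 4 ^ k + 2" for k
  proof -
    have "3 dvd 52 * 4 ^ k + (2 :: nat)"
      by (induction k) (simp_all, presburger)
    then show ?thesis by (simp add: c_def)
  qed
  have c_even: "even (c k)" for k
  proof -
    have "even (3 * c k)" unfolding c by simp
    then show ?thesis by simp
  qed
  have c_Suc: "c (Suc k) = 2 * (2 * c k - 1)" for k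
    using c[of k] c[of "Suc k"] by simp
  have c_pos: "0 < c k" for k using c[of k] by simp
  have ceil_even: "nat \<lceil>(13 / 48 :: real) * 2 ^ (2 * k + 6)\<rceil> = c k" for k
  proof -
    have "3 * real (c k) = 52 * 4 ^ k + 2" using c[of k] by (simp flip: of_nat_eq_iff[where 'a = real])
    moreover have "(13 / 48 :: real) * 2 ^ (2 * k + 6) = 52 * 4 ^ k / 3"
      by (simp add: power_add power_mult)
    ultimately have "\<lceil>(13 / 48 :: real) * 2 ^ (2 * k + 6)\<rceil> = int (c k)"
      by (intro ceiling_unique) auto
    then show ?thesis by simp
  qed
  have ceil_odd: "nat \<lceil>(13 / 48 :: real) * 2 ^ (2 * k + 7)\<rceil> = 2 * c k - 1" for k
  proof -
    have "3 * real (c k) = 52 * 4 ^ k + 2" using c[of k] by (simp flip: of_nat_eq_iff[where 'a = real])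
    moreover have "(13 / 48 :: real) * 2 ^ (2 * k + 7) = 104 * 4 ^ k / 3"
      by (simp add: power_add power_mult)
    moreover have "int (2 * c k - 1) = 2 * int (c k) - 1" using c_pos[of k] by simp
    ultimately have "\<lceil>(13 / 48 :: real) * 2 ^ (2 * k + 7)\<rceil> = int (2 * c k - 1)"
      by (intro ceiling_unique) auto
    then show ?thesis by simp
  qed
  have odd: "forces_thr TYPE('a) (2 * k + 7) (2 * c k - 1)" if "forces_thr TYPE('a) (2 * k + 6) (c k)" for k
    using forces_thr_double_even[OF that _ c_pos c_even] by (simp add: add.commute)
  have even: "forces_thr TYPE('a) (2 * k + 6) (c k)" for k
  proof (induction k)
    case 0
    have "c 0 = 18" by (simp add: c_def)
    then show ?case using forces_thr_6 by simp
  next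
    case (Suc k)
    have "0 < 2 * c k - 1" using c_pos[of k] by simp
    then show ?case
      using forces_thr_double[OF odd[OF Suc]] unfolding c_Suc by (simp add: add.commute)
  qed
  show ?thesis unfolding ceil_even ceil_odd using even odd by blast
qed

lemma forces_thr_ceiling:
  assumes "6 \<le> s"
  shows "forces_thr TYPE('a) s (nat \<lceil>(13 / 48 :: real) * 2 ^ s\<rceil>)"
proof (cases "even s")
  case True
  then have "s = 2 * ((s - 6) div 2) + 6" using assms by presburger
  then show ?thesis using forces_thr_even by metis
next
  case False
  then have "s = 2 * ((s - 6) div 2) + 7" using assms by presburger
  then show ?thesis using forces_thr_even by metis
qed

section \<open>From nested neighbourhoods to induced subgraphs\<close>

lemma thr_induced:
  fixes E :: "'a set set"
  defines "R \<equiv> \<lambda>u v. {u, v} \<in> E"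
  assumes "E \<subseteq> nsets V 2"
  shows "0 < k \<Longrightarrow> thr R k S \<Longrightarrow> \<exists>T\<subseteq>S. card T = k \<and> finite T \<and> threshold_graph T (induced_edges E T)"
proof (induction k arbitrary: S)
  case (Suc k)
  have E: "card e = 2" if "e \<in> E" for e using that assms(2) by (auto simp: nsets_def)
  show ?case
  proof (cases k)
    case 0
    then obtain v where v: "v \<in> S" using Suc.prems by auto
    have "e \<notin> induced_edges E {v}" for e
      using E[of e] card_mono[of "{v}" e] by (auto simp: induced_edges_def)
    then have "induced_edges E {v} = {}" by blast
    then show ?thesis using v 0 threshold_graph.one_vertex[of v] by (intro exI[of _ "{v}"]) auto
  next
    case (Suc j)
    \<comment> \<open>\<open>b\<close> records whether \<open>v\<close> is added last as a
      dominating or as an isolated vertex.\<close>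
    then obtain v b where v: "v \<in> S" "thr R k (nb (if b then R else non R) S v)"
      using \<open>thr R (Suc k) S\<close> by (metis thr.simps(3))
    then obtain T where T: "T \<subseteq> nb (if b then R else non R) S v" "card T = k" "finite T"
        "threshold_graph T (induced_edges E T)"
      using Suc.IH Suc by blast
    have vT: "v \<notin> T" using T(1) by (auto simp: nb_def)
    have other: "\<exists>u. e = {u, v} \<and> u \<noteq> v" if e: "e \<in> E" "v \<in> e" for e
    proof -
      obtain x y where "e = {x, y}" "x \<noteq> y" using E[OF e(1)] by (meson card_2_iff)
      then show ?thesis using e(2) by (auto simp: insert_commute)
    qed
    have "threshold_graph (insert v T) (induced_edges E (insert v T))"
    proof (cases b)
      case True
      have "R v u" if "u \<in> T" for u using True that T(1) by (auto simp: nb_def)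
      then have "{u, v} \<in> E" if "u \<in> T" for u using that by (simp add: R_def insert_commute)
      then have "induced_edges E (insert v T) = induced_edges E T \<union> (\<lambda>u. {u, v}) ` T"
        using other by (fastforce simp: induced_edges_def)
      then show ?thesis using threshold_graph.add_dominating[OF T(4) vT] by simp
    next
      case False
      have "\<not> R v u" if "u \<in> T" for u using False that T(1) by (auto simp: nb_def non_def)
      then have "{u, v} \<notin> E" if "u \<in> T" for u using that by (simp add: R_def insert_commute)
      then have "induced_edges E (insert v T) = induced_edges E T"
        using other by (fastforce simp: induced_edges_def)
      then show ?thesis using threshold_graph.add_isolated[OF T(4) vT] by simp
    qed
    moreover have "insert v T \<subseteq> S" using v T(1) by (auto simp: nb_def)
    ultimately show ?thesis using T(2,3) vT by (intro exI[of _ "insert v T"]) simp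
  qed
qed simp

lemma contains_induced_threshold_of_card:
  assumes "6 \<le> s" "simple_graph V E" "nat \<lceil>(13 / 48 :: real) * 2 ^ s\<rceil> \<le> card V"
  shows "contains_induced_threshold V E s"
proof -
  have "symp (\<lambda>u v. {u, v} \<in> E)" by (auto simp: symp_def insert_commute)
  then have "thr (\<lambda>u v. {u, v} \<in> E) s V"
    using forces_thr_ceiling[OF assms(1)] assms(2,3) by (auto simp: forces_thr_def simple_graph_def)
  then show ?thesis
    using thr_induced[of E V s V] assms(1,2)
    by (auto simp: contains_induced_threshold_def simple_graph_def)
qed

theorem theorem1p2:
  "\<exists>\<epsilon> :: nat \<Rightarrow> real. \<epsilon> \<longlonglongrightarrow> 0 \<and>
     (\<forall>\<^sub>F s in sequentially.
        (sqrt 2 * ln 2 - \<epsilon> s) * 2 powr (real s / 2) < real (r2' s) \<and>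
        int (r2' s) \<le> \<lceil>(13 / 48 :: real) * 2 ^ s\<rceil>)"
proof (intro exI conjI)
  \<comment> \<open>With this choice the left-hand side is exactly
    \<open>lower_bound s\<close>.\<close>
  let ?\<epsilon> = "\<lambda>s. sqrt 2 * ln 2 - lower_bound s / 2 powr (real s / 2)"
  show "?\<epsilon> \<longlonglongrightarrow> 0"
    using tendsto_diff[OF tendsto_const lower_bound_asymp, of "sqrt 2 * ln 2"] by simp
  show "\<forall>\<^sub>F s in sequentially.
      (sqrt 2 * ln 2 - ?\<epsilon> s) * 2 powr (real s / 2) < real (r2' s) \<and>
      int (r2' s) \<le> \<lceil>(13 / 48 :: real) * 2 ^ s\<rceil>"
    using eventually_ge_at_top[of 6]
  proof eventually_elim
    case (elim s)
    let ?P = "\<lambda>n. \<forall>(V :: nat set) E. simple_graph V E \<and> card V = n \<longrightarrow>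
      contains_induced_threshold V E s"
    let ?m = "nat \<lceil>(13 / 48 :: real) * 2 ^ s\<rceil>"
    have m: "?P ?m"
      using contains_induced_threshold_of_card[OF elim] by (metis order_refl)
    have "r2' s \<le> ?m"
      unfolding r2'_def using m by (rule Least_le)
    moreover have "0 \<le> \<lceil>(13 / 48 :: real) * 2 ^ s\<rceil>"
      by (rule order_trans[OF _ ceiling_mono[of 0]]) auto
    ultimately have "int (r2' s) \<le> \<lceil>(13 / 48 :: real) * 2 ^ s\<rceil>" by linarith
    \<comment> \<open>The minimum is attained because \<open>?m\<close> is a witness, so
      \<open>lower_bound_less\<close> applies to \<open>r2' s\<close> itself.\<close>
    moreover have "?P (r2' s)"
      unfolding r2'_def using m by (rule LeastI)
    then have "lower_bound s < real (r2' s)"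
      using elim by (intro lower_bound_less) auto
    ultimately show ?case by simp
  qed
qed

end
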